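(* Let $\mu$ be a probability measure on $\mathbb N^d$ with downward closed support. Suppose that $\mu\in\mathrm{WLSI}(1)$ has (finite) mean vector $\mathbf m\in\mathbb R_{>0}^d$, and let $\pi_{\mathbf m}=\bigotimes_{i=1}^d\mathrm{Pois}(m_i)$. Then $$H(\pi_{\mathbf m})-H(\mu)\;\ge\;\mathrm{KL}(\mu\,\|\,\pi_{\mathbf m})\;\ge\;0 .$$ Consequently, $\pi_{\mathbf m}$ is the unique maximizer of the Shannon entropy $H$ among all measures in $\mathrm{WLSI}(1)$ with mean $\mathbf m$.
   Context: $\mathbb N=\{0,1,2,\dots\}$; $\mathbf e_i$ is the $i$-th standard basis vector. A set $S\subseteq\mathbb N^d$ is downward closed if $\mathbf n\in S$ and $\mathbf 0\le\mathbf m\le\mathbf n$ (coordinatewise) imply $\mathbf m\in S$. Shannon entropy: $H(\mu)=-\sum_{\mathbf n\in\mathrm{supp}(\mu)}\mu(\mathbf n)\log\mu(\mathbf n)$. Relative entropy: $\mathrm{KL}(\mu\|\nu)=\sum_{\mathbf n\in\mathrm{supp}(\mu)}\mu(\mathbf n)\log\frac{\mu(\mathbf n)}{\nu(\mathbf n)}$. Let $\mu$ be a probability measure on $\mathbb N^d$ with downward closed support and finite mean vector with positive entries. For $\mathbf n\in\mathrm{supp}(\mu)$ let $b_i(\mathbf n)=(n_i+1)\mu(\mathbf n+\mathbf e_i)/\mu(\mathbf n)$, and for $f:\mathrm{supp}(\mu)\to\mathbb R$ let $\nabla_i^+f(\mathbf n)=f(\mathbf n+\mathbf e_i)-f(\mathbf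 n)$; terms with $\mathbf n+\mathbf e_i\notin\mathrm{supp}(\mu)$ have $b_i(\mathbf n)=0$ and are interpreted as $0$. Let $\mathcal E(f,f)=\mathbf E_\mu\big[\sum_{i=1}^d b_i(\nabla_i^+f)^2\big]$, $\mathcal D(\mathcal E)=\{f\in L^2(\mu):\mathcal E(f,f)<\infty\}$, $\mathcal A=\{f\in L^2(\mu):f>0,\ f\in\mathcal D(\mathcal E),\ \log f\in\mathcal D(\mathcal E)\}$, $\Psi(u,v)=(u+v)\log(u+v)-u\log u-v(\log u+1)$ with $\Psi(0,0)=0$, and $\mathrm{Ent}_\mu[f]=\mathbf E_\mu[f\log f]-\mathbf E_\mu[f]\log\mathbf E_\mu[f]$. We write $\mu\in\mathrm{WLSI}(1)$ if $$\mathrm{Ent}_\mu[f]\le\mathbf E_\mu\Big[\sum_{i=1}^d b_i\,\Psi(f,\nabla_i^+f)\Big]\qquad\text{for all } f\in\mathcal A .$$ Membership in $\mathrm{WLSI}(1)$ is considered only for probability measures with downward closed support. *)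

theory Defs
  imports "HOL-Probability.Probability"
begin

text \<open>
  Points of \<open>\<nat>\<^sup>d\<close> are functions \<^typ>\<open>'d \<Rightarrow> nat\<close> with \<^typ>\<open>'d\<close> a finite type, ordered pointwise;
  probability measures on \<open>\<nat>\<^sup>d\<close> are probability mass functions. Functions on the support are
  total functions whose values off the support never matter, since \<open>birth_rate \<mu> i n = 0\<close> whenever
  \<open>n + e\<^sub>i\<close> lies outside the support.
\<close>

definition downward_closed :: "('d \<Rightarrow> nat) set \<Rightarrow> bool" where
  "downward_closed S \<longleftrightarrow> (\<forall>n\<in>S. \<forall>k. k \<le> n \<longrightarrow> k \<in> S)"

text \<open>
  The summands are nonnegative, so the sum always exists in \<^typ>\<open>ereal\<close>.
\<close>

definition shannon_entropy :: "'a pmf \<Rightarrow> ereal" where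
  "shannon_entropy \<mu> = (\<Sum>\<^sub>\<infinity>n\<in>set_pmf \<mu>. ereal (- (pmf \<mu> n * ln (pmf \<mu> n))))"

text \<open>
  The negative parts of the summands have a finite sum, so this sum also always exists in
  \<^typ>\<open>ereal\<close>, possibly with value \<open>\<infinity>\<close>. The real-valued \<^const>\<open>KL_divergence\<close> would be \<open>0\<close> in that
  case. The case distinction is the usual convention \<open>ln (x / 0) = \<infinity>\<close> for \<open>x > 0\<close>.
\<close>

definition relative_entropy :: "'a pmf \<Rightarrow> 'a pmf \<Rightarrow> ereal" where
  "relative_entropy \<mu> \<nu> = (\<Sum>\<^sub>\<infinity>n\<in>set_pmf \<mu>.
     if pmf \<nu> n = 0 then \<infinity> else ereal (pmf \<mu> n * ln (pmf \<mu> n / pmf \<nu> n)))"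

definition has_mean :: "('d \<Rightarrow> nat) pmf \<Rightarrow> ('d \<Rightarrow> real) \<Rightarrow> bool" where
  "has_mean \<mu> m \<longleftrightarrow>
     (\<forall>i. integrable (measure_pmf \<mu>) (\<lambda>n. real (n i)) \<and>
          measure_pmf.expectation \<mu> (\<lambda>n. real (n i)) = m i)"

definition incr :: "'d \<Rightarrow> ('d \<Rightarrow> nat) \<Rightarrow> ('d \<Rightarrow> nat)" where
  "incr i n = n(i := n i + 1)"

definition birth_rate :: "('d \<Rightarrow> nat) pmf \<Rightarrow> 'd \<Rightarrow> ('d \<Rightarrow> nat) \<Rightarrow> real" where
  "birth_rate \<mu> i n = (real (n i) + 1) * pmf \<mu> (incr i n) / pmf \<mu> n"

definition grad :: "'d \<Rightarrow> (('d \<Rightarrow> nat) \<Rightarrow> real) \<Rightarrow> ('d \<Rightarrow> nat) \<Rightarrow> real" where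
  "grad i f n = f (incr i n) - f n"

definition dirichlet_energy :: "('d::finite \<Rightarrow> nat) pmf \<Rightarrow> (('d \<Rightarrow> nat) \<Rightarrow> real) \<Rightarrow> ennreal" where
  "dirichlet_energy \<mu> f =
     (\<integral>\<^sup>+n. ennreal (\<Sum>i\<in>UNIV. birth_rate \<mu> i n * (grad i f n)\<^sup>2) \<partial>measure_pmf \<mu>)"

definition square_integrable :: "'a pmf \<Rightarrow> ('a \<Rightarrow> real) \<Rightarrow> bool" where
  "square_integrable \<mu> f \<longleftrightarrow> integrable (measure_pmf \<mu>) (\<lambda>n. (f n)\<^sup>2)"

definition dirichlet_domain :: "('d::finite \<Rightarrow> nat) pmf \<Rightarrow> (('d \<Rightarrow> nat) \<Rightarrow> real) set" where
  "dirichlet_domain \<mu> = {f. square_integrable \<mu> f \<and> dirichlet_energy \<mu> f < \<infinity>}"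

definition admissible :: "('d::finite \<Rightarrow> nat) pmf \<Rightarrow> (('d \<Rightarrow> nat) \<Rightarrow> real) set" where
  "admissible \<mu> = {f. square_integrable \<mu> f \<and> (\<forall>n\<in>set_pmf \<mu>. 0 < f n) \<and>
     f \<in> dirichlet_domain \<mu> \<and> (\<lambda>n. ln (f n)) \<in> dirichlet_domain \<mu>}"

text \<open>Since \<open>ln 0 = 0\<close>, this formula also gives the value \<open>0\<close> at \<open>(0, 0)\<close>.\<close>

definition Psi :: "real \<Rightarrow> real \<Rightarrow> real" where
  "Psi u v = (u + v) * ln (u + v) - u * ln u - v * (ln u + 1)"

definition Ent :: "'a pmf \<Rightarrow> ('a \<Rightarrow> real) \<Rightarrow> real" where
  "Ent \<mu> f = measure_pmf.expectation \<mu> (\<lambda>n. f n * ln (f n))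
     - measure_pmf.expectation \<mu> f * ln (measure_pmf.expectation \<mu> f)"

text \<open>
  For admissible \<open>f\<close> all the integrals below are finite: \<open>f * ln f\<close> lies between \<open>-1/e\<close> and \<open>f\<^sup>2\<close>,
  and \<open>0 \<le> Psi f (grad i f) \<le> grad i f * grad i (ln f) \<le> ((grad i f)\<^sup>2 + (grad i (ln f))\<^sup>2) / 2\<close>.
\<close>

definition WLSI1 :: "('d::finite \<Rightarrow> nat) pmf set" where
  "WLSI1 = {\<mu>. downward_closed (set_pmf \<mu>) \<and>
     (\<forall>f\<in>admissible \<mu>.
        Ent \<mu> f \<le> measure_pmf.expectation \<mu>
          (\<lambda>n. \<Sum>i\<in>UNIV. birth_rate \<mu> i n * Psi (f n) (grad i f n)))}"

text \<open>The default value \<open>0\<close> of \<^const>\<open>Pi_pmf\<close> is irrelevant, as the index set is \<^term>\<open>UNIV\<close>.\<close>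

definition poisson_product :: "('d::finite \<Rightarrow> real) \<Rightarrow> ('d \<Rightarrow> nat) pmf" where
  "poisson_product m = Pi_pmf UNIV 0 (\<lambda>i. poisson_pmf (m i))"

end

theory Submission
  imports Defs
begin

text \<open>
  Testing \<open>WLSI(1)\<close> with truncations of \<open>f = z ^ n\<^sub>i\<close>, \<open>0 < z < 1\<close>, gives \<open>- G ln G \<le> (1 - z) G'\<close> for the
  generating function \<open>G(z)\<close> of the \<open>i\<close>-th marginal, so \<open>ln G(z) / (1 - z)\<close> is nondecreasing, with
  limit \<open>- m\<^sub>i\<close> at \<open>1\<close>; hence \<open>G\<close> lies below the Poisson generating function. As \<open>ln (n!)\<close> is a
  positive mixture over \<open>z\<close> of the functions \<open>n (1 - z) - 1 + z ^ n\<close>, this yields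
  \<open>E\<^sub>\<mu> ln (n\<^sub>i!) \<le> E\<^sub>\<pi> ln (n\<^sub>i!)\<close>, that is \<open>- E\<^sub>\<mu> ln \<pi> \<le> - E\<^sub>\<pi> ln \<pi> = H(\<pi>)\<close>, and
  \<open>KL(\<mu> | \<pi>) = - E\<^sub>\<mu> ln \<pi> - H(\<mu>)\<close>.

  That \<open>\<pi>\<close> itself lies in \<open>WLSI(1)\<close> follows by subadditivity: for a Poisson variable of small
  parameter \<open>t\<close> the inequality holds up to an error \<open>O(t\<^sup>2)\<close> by convexity alone, errors add up under
  convolution because the Bregman divergence of \<open>x ln x\<close> is jointly convex, and \<open>\<pi>\<close> is a
  convolution of \<open>O(1/t)\<close> such variables.
\<close>

subsection \<open>The Bregman divergence of \<open>x ln x\<close>\<close>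

text \<open>With \<Phi>(x) = x ln x this is \<Phi>(b) - \<Phi>(a) - \<Phi>'(a) (b - a): the base
  point is the second argument, so that \<open>Psi u v\<close> becomes
  \<open>bregman (u + v) u\<close>.\<close>

definition bregman :: "real \<Rightarrow> real \<Rightarrow> real" where
  "bregman b a = b * ln b - b * ln a - b + a"

lemma Psi_grad: "Psi (f n) (grad i f n) = bregman (f (incr i n)) (f n)"
  by (simp add: Psi_def grad_def bregman_def algebra_simps)

lemma bregman_refl [simp]: "bregman a a = 0"
  by (simp add: bregman_def)

lemma bregman_nonneg:
  assumes "0 < a" "0 < b"
  shows "0 \<le> bregman b a"
proof -
  have "b * ln (a / b) \<le> b * (a / b - 1)"
    using assms by (intro mult_left_mono ln_le_minus_one) auto
  then show ?thesis
    using assms by (simp add: bregman_def ln_div algebra_simps)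
qed

text \<open>The right-hand side is the symmetrised divergence
  \<open>bregman b a + bregman a b\<close>, whose second summand is nonnegative.\<close>

lemma bregman_le:
  assumes "0 < a" "0 < b"
  shows "bregman b a \<le> (b - a) * (ln b - ln a)"
proof -
  have "a * ln (b / a) \<le> a * (b / a - 1)"
    using assms by (intro mult_left_mono ln_le_minus_one) auto
  then show ?thesis
    using assms by (simp add: bregman_def ln_div algebra_simps)
qed

text \<open>Joint convexity, as a supporting plane at \<open>(b0, a0)\<close>. The difference of the
  two sides is exactly \<open>bregman b (a * (b0 / a0))\<close>, which is nonnegative.\<close>

lemma bregman_tangent:
  assumes "0 < a" "0 < b" "0 < a0" "0 < b0"
  shows "bregman b0 a0 + (ln b0 - ln a0) * (b - b0) + (1 - b0 / a0) * (a - a0) \<le> bregman b a"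
proof -
  have "0 \<le> bregman b (a * (b0 / a0))"
    using assms by (intro bregman_nonneg) auto
  then show ?thesis
    using assms by (simp add: bregman_def ln_mult ln_div field_simps)
qed

text \<open>The upper bound depends only on the interval. It serves for integrability and is the
  constant in the error term for small Poisson parameters.\<close>

lemma bregman_bounds:
  assumes "0 < c" "c \<le> a" "a \<le> C" "c \<le> b" "b \<le> C"
  shows "0 \<le> bregman b a" "bregman b a \<le> (C - c) * (ln C - ln c)"
proof -
  have ab: "0 < a" "0 < b" using assms by auto
  show "0 \<le> bregman b a" using ab by (rule bregman_nonneg)
  have "bregman b a \<le> \<bar>b - a\<bar> * \<bar>ln b - ln a\<bar>"
    using bregman_le[OF ab] by (metis abs_ge_self abs_mult order_trans)
  also have "\<dots> \<le> (C - c) * (ln C - ln c)"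
  proof (intro mult_mono)
    have "ln c \<le> ln a" "ln a \<le> ln C" "ln c \<le> ln b" "ln b \<le> ln C"
      using assms by auto
    then show "\<bar>ln b - ln a\<bar> \<le> ln C - ln c" by auto
  qed (use assms in auto)
  finally show "bregman b a \<le> (C - c) * (ln C - ln c)" .
qed

lemma abs_bregman_le:
  assumes "0 < c" "c \<le> a \<and> a \<le> C" "c \<le> b \<and> b \<le> C"
  shows "\<bar>bregman b a\<bar> \<le> (C - c) * (ln C - ln c)"
  using bregman_bounds[of c a C b] assms by auto

section \<open>Expectations of bounded functions and Jensen's inequality for the divergence\<close>

lemma integrable_pmf_bounded:
  fixes f :: "'a \<Rightarrow> real"
  assumes "\<And>x. \<bar>f x\<bar> \<le> B"
  shows "integrable (measure_pmf p) f"
  using assms by (intro measure_pmf.integrable_const_bound[where B = B]) auto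

lemma expectation_mem_interval:
  fixes f :: "'a \<Rightarrow> real"
  assumes "\<And>x. c \<le> f x \<and> f x \<le> C"
  shows "c \<le> measure_pmf.expectation p f" "measure_pmf.expectation p f \<le> C"
proof -
  have int: "integrable (measure_pmf p) f"
    by (rule integrable_pmf_bounded[of _ "max \<bar>c\<bar> \<bar>C\<bar>"]) (use assms in smt)
  show "c \<le> measure_pmf.expectation p f"
    using assms by (intro measure_pmf.integral_ge_const int) auto
  show "measure_pmf.expectation p f \<le> C"
    using assms by (intro measure_pmf.integral_le_const int) auto
qed

lemma abs_expectation_le:
  fixes f :: "'a \<Rightarrow> real"
  assumes "\<And>x. \<bar>f x\<bar> \<le> B"
  shows "\<bar>measure_pmf.expectation p f\<bar> \<le> B"
  using expectation_mem_interval[of "-B" f B p] assms by (simp add: abs_le_iff minus_le_iff)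

lemma expectation_pos:
  fixes f :: "'a \<Rightarrow> real"
  assumes "integrable (measure_pmf p) f" and pos: "\<And>x. 0 < f x"
  shows "0 < measure_pmf.expectation p f"
proof -
  have "0 \<le> measure_pmf.expectation p f"
    using pos by (intro integral_nonneg_AE) (auto intro: less_imp_le)
  moreover have "measure_pmf.expectation p f \<noteq> 0"
    using assms by (subst integral_nonneg_eq_0_iff_AE)
      (auto simp: AE_measure_pmf_iff set_pmf_not_empty less_imp_le less_imp_neq[THEN not_sym])
  ultimately show ?thesis by simp
qed

lemma expectation_bind_pmf_bounded:
  fixes f :: "'b \<Rightarrow> real"
  assumes "\<And>x. \<bar>f x\<bar> \<le> B"
  shows "measure_pmf.expectation (bind_pmf p q) f
    = measure_pmf.expectation p (\<lambda>x. measure_pmf.expectation (q x) f)"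
  unfolding measure_pmf_bind
  by (rule integral_bind[where K = "count_space UNIV" and B' = 1 and B = B])
    (use assms in \<open>auto simp: measure_pmf_in_subprob_algebra intro!: measure_pmf.emeasure_le_1\<close>)

text \<open>Integrate \<open>bregman_tangent\<close> with the two means as base point: the linear
  terms have expectation zero.\<close>

lemma jensen_bregman:
  assumes "0 < c" and f: "\<And>x. c \<le> f x \<and> f x \<le> C" and g: "\<And>x. c \<le> g x \<and> g x \<le> C"
  shows "bregman (measure_pmf.expectation p g) (measure_pmf.expectation p f)
    \<le> measure_pmf.expectation p (\<lambda>x. bregman (g x) (f x))"
proof -
  define a where "a = measure_pmf.expectation p f"
  define b where "b = measure_pmf.expectation p g"
  have pos: "0 < a" "0 < b" "\<And>x. 0 < f x" "\<And>x. 0 < g x"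
    using \<open>0 < c\<close> f g expectation_mem_interval[of c f C p] expectation_mem_interval[of c g C p]
    unfolding a_def b_def by (smt (verit))+
  have intf: "integrable (measure_pmf p) f" and intg: "integrable (measure_pmf p) g"
    by (rule integrable_pmf_bounded[of _ C]; use assms in smt)+
  have intb: "integrable (measure_pmf p) (\<lambda>x. bregman (g x) (f x))"
    by (rule integrable_pmf_bounded[of _ "(C - c) * (ln C - ln c)"])
      (intro abs_bregman_le assms)
  have "bregman b a = measure_pmf.expectation p
      (\<lambda>x. bregman b a + (ln b - ln a) * (g x - b) + (1 - b / a) * (f x - a))"
    using intf intg by (simp add: a_def b_def)
  also have "\<dots> \<le> measure_pmf.expectation p (\<lambda>x. bregman (g x) (f x))"
    using intf intg intb pos by (intro integral_mono bregman_tangent) auto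
  finally show ?thesis by (simp add: a_def b_def)
qed

subsection \<open>Membership of the Poisson product\<close>

text \<open>The weighted inequality with constant rates \<open>w\<close> and additive error \<open>\<epsilon>\<close>. Bounding \<open>f\<close> away
  from \<open>0\<close> and \<open>\<infinity>\<close> makes all integrals finite and the error uniform in \<open>f\<close>.\<close>

definition approx_lsi ::
  "real \<Rightarrow> real \<Rightarrow> ('d::finite \<Rightarrow> nat) pmf \<Rightarrow> ('d \<Rightarrow> real) \<Rightarrow> real \<Rightarrow> bool" where
  "approx_lsi c C q w \<epsilon> \<longleftrightarrow> (\<forall>f. (\<forall>n. c \<le> f n \<and> f n \<le> C) \<longrightarrow>
     Ent q f \<le> measure_pmf.expectation q (\<lambda>n. \<Sum>i\<in>UNIV. w i * bregman (f (incr i n)) (f n)) + \<epsilon>)"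

definition convolution :: "('d \<Rightarrow> nat) pmf \<Rightarrow> ('d \<Rightarrow> nat) pmf \<Rightarrow> ('d \<Rightarrow> nat) pmf" where
  "convolution q q' = bind_pmf q (\<lambda>k. map_pmf (\<lambda>l i. k i + l i) q')"

lemma expectation_convolution:
  fixes f :: "('d \<Rightarrow> nat) \<Rightarrow> real"
  assumes "\<And>x. \<bar>f x\<bar> \<le> B"
  shows "measure_pmf.expectation (convolution q q') f
    = measure_pmf.expectation q (\<lambda>k. measure_pmf.expectation q' (\<lambda>l. f (\<lambda>i. k i + l i)))"
  unfolding convolution_def using assms by (subst expectation_bind_pmf_bounded[of f B]) auto

lemma abs_mult_ln_le:
  fixes x :: real
  assumes "0 < c" "c \<le> x" "x \<le> C"
  shows "\<bar>x * ln x\<bar> \<le> C * (\<bar>ln c\<bar> + \<bar>ln C\<bar>)"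
proof -
  have "ln c \<le> ln x" "ln x \<le> ln C" using assms by (simp_all add: ln_mono)
  then have "\<bar>ln x\<bar> \<le> \<bar>ln c\<bar> + \<bar>ln C\<bar>" by linarith
  then show ?thesis unfolding abs_mult using assms by (intro mult_mono) auto
qed

text \<open>Condition on the first summand \<open>k\<close>. The second hypothesis controls the
  entropy of \<open>f\<close> given \<open>k\<close>, the first one the entropy of the conditional
  mean \<open>F\<close>, and Jensen bounds the divergences of \<open>F\<close> by conditional means
  of those of \<open>f\<close>. Incrementing either summand increments the sum, so both bounds
  involve the same \<open>D\<close> and the rates add up.\<close>

lemma approx_lsi_convolution:
  fixes w :: "'d::finite \<Rightarrow> real"
  assumes "0 < c" and w: "\<And>i. 0 \<le> w i"
    and 1: "approx_lsi c C q w \<epsilon>" and 2: "approx_lsi c C q' w' \<epsilon>'"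
  shows "approx_lsi c C (convolution q q') (\<lambda>i. w i + w' i) (\<epsilon> + \<epsilon>')"
  unfolding approx_lsi_def
proof (intro allI impI)
  fix f :: "('d \<Rightarrow> nat) \<Rightarrow> real" assume f: "\<forall>n. c \<le> f n \<and> f n \<le> C"
  let ?E = measure_pmf.expectation
  let ?B = "(C - c) * (ln C - ln c)"
  let ?L = "C * (\<bar>ln c\<bar> + \<bar>ln C\<bar>)"
  define F where "F k = ?E q' (\<lambda>l. f (\<lambda>i. k i + l i))" for k
  define G where "G k = ?E q' (\<lambda>l. f (\<lambda>i. k i + l i) * ln (f (\<lambda>i. k i + l i)))" for k
  define D where "D i k = ?E q' (\<lambda>l. bregman (f (incr i (\<lambda>i. k i + l i))) (f (\<lambda>i. k i + l i)))" for i k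
  have F: "c \<le> F k \<and> F k \<le> C" for k
    unfolding F_def using f expectation_mem_interval[of c _ C q'] by auto
  have fB: "\<bar>f n\<bar> \<le> C" for n
    using f \<open>0 < c\<close> by (smt (verit))
  have fL: "\<bar>f n * ln (f n)\<bar> \<le> ?L" for n
    using f \<open>0 < c\<close> by (intro abs_mult_ln_le) auto
  have fD: "0 \<le> bregman (f n') (f n)" "bregman (f n') (f n) \<le> ?B" for n n'
    using f \<open>0 < c\<close> bregman_bounds[of c "f n" C "f n'"] by auto
  have fD': "\<bar>bregman (f n') (f n)\<bar> \<le> ?B" for n n'
    using fD by auto
  have FD: "\<bar>bregman (F n') (F n)\<bar> \<le> ?B" for n n'
    using F \<open>0 < c\<close> bregman_bounds[of c "F n" C "F n'"] by auto
  have FL: "\<bar>F n * ln (F n)\<bar> \<le> ?L" for n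
    using F \<open>0 < c\<close> by (intro abs_mult_ln_le) auto
  have GB: "\<bar>G k\<bar> \<le> ?L" for k
    unfolding G_def using fL by (rule abs_expectation_le)
  have DB: "\<bar>D i k\<bar> \<le> ?B" for i k
    unfolding D_def using fD' by (rule abs_expectation_le)
  have ints: "integrable q G" "integrable q (\<lambda>k. F k * ln (F k))" "\<And>i. integrable q (D i)"
    "\<And>i. integrable q (\<lambda>k. bregman (F (incr i k)) (F k))"
    by (rule integrable_pmf_bounded[OF GB] integrable_pmf_bounded[OF FL] integrable_pmf_bounded[OF DB]
        integrable_pmf_bounded[OF FD])+
  have incr: "(\<lambda>j. incr i k j + l j) = incr i (\<lambda>j. k j + l j)" for i and k l :: "'d \<Rightarrow> nat"
    by (auto simp: incr_def)
  have incr': "(\<lambda>j. k j + incr i l j) = incr i (\<lambda>j. k j + l j)" for i and k l :: "'d \<Rightarrow> nat"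
    by (auto simp: incr_def)
  have "integrable (measure_pmf q') (\<lambda>l. bregman (f (incr i (\<lambda>j. k j + l j))) (f (\<lambda>j. k j + l j)))" for i k
    using fD' by (rule integrable_pmf_bounded)
  \<comment> \<open>The hypothesis on \<open>q'\<close>, applied to \<open>f\<close> translated by
    \<open>k\<close>; the translate stays between \<open>c\<close> and \<open>C\<close>.\<close>
  then have A: "G k - F k * ln (F k) \<le> (\<Sum>i\<in>UNIV. w' i * D i k) + \<epsilon>'" for k
    using 2[unfolded approx_lsi_def, rule_format, of "\<lambda>l. f (\<lambda>i. k i + l i)"] f
    by (simp add: Ent_def F_def G_def D_def incr')
  have B: "bregman (F (incr i k)) (F k) \<le> D i k" for i k
    unfolding F_def D_def incr using f \<open>0 < c\<close> by (intro jensen_bregman[of c _ C]) auto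
  have F_lsi: "Ent q F \<le> ?E q (\<lambda>k. \<Sum>i\<in>UNIV. w i * bregman (F (incr i k)) (F k)) + \<epsilon>"
    using 1 F by (simp add: approx_lsi_def)
  have "Ent (convolution q q') f = ?E q G - ?E q F * ln (?E q F)"
    unfolding Ent_def expectation_convolution[OF fL] expectation_convolution[OF fB] F_def G_def ..
  \<comment> \<open>Chain rule for entropy: add and subtract the expectation of
    \<open>F k * ln (F k)\<close>.\<close>
  also have "\<dots> = ?E q (\<lambda>k. G k - F k * ln (F k)) + Ent q F"
    using ints by (simp add: Ent_def)
  also have "\<dots> \<le> ?E q (\<lambda>k. (\<Sum>i\<in>UNIV. w' i * D i k) + \<epsilon>') + (?E q (\<lambda>k. \<Sum>i\<in>UNIV. w i * bregman (F (incr i k)) (F k)) + \<epsilon>)"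
    using A ints by (intro add_mono F_lsi integral_mono) auto
  also have "\<dots> \<le> ?E q (\<lambda>k. (\<Sum>i\<in>UNIV. w' i * D i k) + \<epsilon>') + (?E q (\<lambda>k. \<Sum>i\<in>UNIV. w i * D i k) + \<epsilon>)"
    using ints w B by (intro add_mono order_refl integral_mono sum_mono mult_left_mono) auto
  also have "\<dots> = (\<Sum>i\<in>UNIV. (w i + w' i) * ?E q (D i)) + (\<epsilon> + \<epsilon>')"
    using ints by (simp add: sum.distrib algebra_simps)
  also have "(\<Sum>i\<in>UNIV. (w i + w' i) * ?E q (D i))
    = ?E (convolution q q') (\<lambda>n. \<Sum>i\<in>UNIV. (w i + w' i) * bregman (f (incr i n)) (f n))"
  proof -
    have "integrable (convolution q q') (\<lambda>n. bregman (f (incr i n)) (f n))" for i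
      by (rule integrable_pmf_bounded[OF fD'])
    then show ?thesis
      by (simp add: expectation_convolution[OF fD'] D_def[abs_def])
  qed
  finally show "Ent (convolution q q') f \<le> \<dots> + (\<epsilon> + \<epsilon>')" .
qed

section \<open>Poisson variables on a coordinate axis\<close>

lemma pmf_conv_nat:
  fixes p q :: "nat pmf"
  shows "pmf (bind_pmf p (\<lambda>k. map_pmf (\<lambda>l. k + l) q)) n = (\<Sum>k\<le>n. pmf p k * pmf q (n - k))"
proof -
  have *: "pmf (map_pmf (\<lambda>l. k + l) q) n = (if k \<le> n then pmf q (n - k) else 0)" for k
  proof (cases "k \<le> n")
    case True
    then show ?thesis
      using pmf_map_inj'[of "\<lambda>l. k + l" q "n - k"] by (simp add: inj_def)
  next
    case False
    then show ?thesis by (auto simp: pmf_eq_0_set_pmf)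
  qed
  have "pmf (bind_pmf p (\<lambda>k. map_pmf (\<lambda>l. k + l) q)) n
      = measure_pmf.expectation p (\<lambda>k. if k \<le> n then pmf q (n - k) else 0)"
    by (simp add: pmf_bind *)
  also have "\<dots> = (\<Sum>k\<le>n. pmf p k * pmf q (n - k))"
    by (subst integral_measure_pmf[of "{..n}"]) (auto simp: mult.commute split: if_splits)
  finally show ?thesis .
qed

text \<open>Up to the factor \<open>exp (- (s + t)) / fact n\<close>, the convolution sum is the
  binomial expansion of \<open>(s + t) ^ n\<close>.\<close>

lemma poisson_pmf_add:
  assumes "0 < s" "0 < t"
  shows "bind_pmf (poisson_pmf s) (\<lambda>k. map_pmf (\<lambda>l. k + l) (poisson_pmf t)) = poisson_pmf (s + t)"
proof (rule pmf_eqI)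
  fix n :: nat
  have "(\<Sum>k\<le>n. s ^ k / fact k * exp (- s) * (t ^ (n - k) / fact (n - k) * exp (- t)))
      = (\<Sum>k\<le>n. (n choose k) * s ^ k * t ^ (n - k)) / fact n * exp (- (s + t))"
    by (simp add: sum_divide_distrib sum_distrib_right binomial_fact exp_diff exp_minus field_simps exp_add)
  then show "pmf (bind_pmf (poisson_pmf s) (\<lambda>k. map_pmf (\<lambda>l. k + l) (poisson_pmf t))) n
      = pmf (poisson_pmf (s + t)) n"
    using assms by (simp add: pmf_conv_nat binomial_ring)
qed

text \<open>Placing one-dimensional laws on an axis turns both the splitting of a Poisson parameter
  and the assembly of the product measure into instances of \<open>convolution\<close>.\<close>

definition axis_pmf :: "'d \<Rightarrow> nat pmf \<Rightarrow> ('d::finite \<Rightarrow> nat) pmf" where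
  "axis_pmf i p = map_pmf (\<lambda>k j. if j = i then k else 0) p"

lemma convolution_axis_pmf:
  "convolution (axis_pmf i p) (axis_pmf i q) = axis_pmf i (bind_pmf p (\<lambda>k. map_pmf (\<lambda>l. k + l) q))"
  by (auto simp: convolution_def axis_pmf_def bind_map_pmf map_bind_pmf pmf.map_comp o_def
      intro!: bind_pmf_cong pmf.map_cong)

text \<open>The complement has probability \<open>(1 + t) * exp (- t)\<close>, which is at least
  \<open>(1 + t) * (1 - t)\<close>.\<close>

lemma prob_poisson_ge_2:
  assumes "0 < t"
  shows "measure_pmf.prob (poisson_pmf t) {2..} \<le> t\<^sup>2"
proof -
  have "measure_pmf.prob (poisson_pmf t) {..<2} = (1 + t) * exp (- t)"
    using assms by (subst measure_measure_pmf_finite) (auto simp: numeral_2_eq_2 algebra_simps)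
  moreover have "measure_pmf.prob (poisson_pmf t) {2..} = 1 - measure_pmf.prob (poisson_pmf t) {..<2}"
    using measure_pmf.prob_compl[of "{..<2}" "poisson_pmf t"] by (simp add: Compl_eq_Diff_UNIV[symmetric])
  moreover have "(1 + t) * (1 - t) \<le> (1 + t) * exp (- t)"
    using assms exp_ge_add_one_self[of "-t"] by (intro mult_left_mono) auto
  ultimately show ?thesis by (simp add: algebra_simps power2_eq_square)
qed

text \<open>To first order in \<open>t\<close> only the jump from 0 to 1 counts. Entropy is at most
  the expected divergence from the value at 0; the point 1 contributes a term that the energy at 0
  pays for, and the points from 2 on have mass at most \<open>t\<^sup>2\<close>.\<close>

lemma approx_lsi_small_poisson:
  fixes i :: "'d::finite"
  assumes "0 < c" "0 < t"
  shows "approx_lsi c C (axis_pmf i (poisson_pmf t)) (\<lambda>j. if j = i then t else 0)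
    ((C - c) * (ln C - ln c) * t\<^sup>2)"
  unfolding approx_lsi_def
proof (intro allI impI)
  fix f :: "('d \<Rightarrow> nat) \<Rightarrow> real" assume f: "\<forall>n. c \<le> f n \<and> f n \<le> C"
  let ?p = "poisson_pmf t" let ?E = "measure_pmf.expectation ?p"
  let ?B = "(C - c) * (ln C - ln c)"
  define g where "g k = f (\<lambda>j. if j = i then k else 0)" for k :: nat
  have g: "c \<le> g k \<and> g k \<le> C" and pos: "0 < g k" for k
    using f \<open>0 < c\<close> less_le_trans[of 0 c "g k"] by (auto simp: g_def)
  have gB: "\<bar>g k\<bar> \<le> C" for k
    using g[of k] pos[of k] by simp
  have gL: "\<bar>g k * ln (g k)\<bar> \<le> C * (\<bar>ln c\<bar> + \<bar>ln C\<bar>)" for k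
    using g \<open>0 < c\<close> by (intro abs_mult_ln_le) auto
  have gD: "\<bar>bregman (g k) (g l)\<bar> \<le> ?B" for k l
    by (intro abs_bregman_le \<open>0 < c\<close> g)
  have B0: "0 \<le> ?B" using gD[of 0 0] by simp
  note ints = integrable_pmf_bounded[OF gB] integrable_pmf_bounded[OF gL] integrable_pmf_bounded[OF gD]
  define a where "a = g 0"
  have "0 < ?E g"
    using expectation_mem_interval(1)[of c g C ?p] g \<open>0 < c\<close> by auto
  have "Ent (axis_pmf i ?p) f = ?E (\<lambda>k. g k * ln (g k)) - ?E g * ln (?E g)"
    unfolding g_def by (simp add: Ent_def axis_pmf_def)
  \<comment> \<open>An identity for every positive base point \<open>a\<close>; the terms affine in
    \<open>g\<close> cancel. The choice \<open>a = g 0\<close> makes the contribution of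
    \<open>k = 0\<close> vanish.\<close>
  also have "\<dots> = ?E (\<lambda>k. bregman (g k) a) - bregman (?E g) a"
  proof -
    have "integrable ?p g" "integrable ?p (\<lambda>k. g k * ln (g k))"
      by (rule ints(1), rule ints(2))
    then show ?thesis by (simp add: bregman_def)
  qed
  also have "\<dots> \<le> ?E (\<lambda>k. bregman (g k) a)"
    using bregman_nonneg[of a "?E g"] pos[of 0] \<open>0 < ?E g\<close> by (simp add: a_def)
  also have "\<dots> \<le> ?E (\<lambda>k. bregman (g 1) a * indicator {1} k + ?B * indicator {2..} k)"
  proof (intro integral_mono)
    fix k
    show "bregman (g k) a \<le> bregman (g 1) a * indicator {1} k + ?B * indicator {2..} k"
      using gD[of k 0] by (cases "k = 0"; cases "k = 1") (auto simp: a_def indicator_def)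
  qed (use ints in \<open>auto simp: a_def measure_pmf.emeasure_eq_measure\<close>)
  also have "\<dots> = bregman (g 1) a * pmf ?p 1 + ?B * measure_pmf.prob ?p {2..}"
    by (simp add: measure_pmf.emeasure_eq_measure measure_pmf_single)
  \<comment> \<open>The Poisson weights satisfy \<open>pmf ?p 1 = t * pmf ?p 0\<close>, which moves
    the mass from 1 back to 0, where the energy sees the jump.\<close>
  also have "\<dots> \<le> t * (bregman (g 1) a * pmf ?p 0) + ?B * t\<^sup>2"
    using assms B0 prob_poisson_ge_2[of t] by (intro add_mono mult_left_mono) auto
  also have "bregman (g 1) a * pmf ?p 0 = ?E (\<lambda>k. bregman (g 1) a * indicator {0} k)"
    by (simp add: measure_pmf.emeasure_eq_measure measure_pmf_single)
  also have "\<dots> \<le> ?E (\<lambda>k. bregman (g (Suc k)) (g k))"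
  proof (intro integral_mono)
    show "integrable ?p (\<lambda>k. bregman (g 1) a * indicator {0} k)"
      by (rule integrable_pmf_bounded[of _ "\<bar>bregman (g 1) a\<bar>"]) (simp add: indicator_def)
    show "bregman (g 1) a * indicator {0} k \<le> bregman (g (Suc k)) (g k)" for k
      using bregman_nonneg[OF pos pos] by (auto simp: a_def indicator_def)
  qed (rule ints)
  also have "\<dots> = measure_pmf.expectation (axis_pmf i ?p) (\<lambda>n. bregman (f (incr i n)) (f n))"
    by (auto simp: axis_pmf_def g_def incr_def fun_upd_def fun_eq_iff
        intro!: Bochner_Integration.integral_cong arg_cong2[of _ _ _ _ bregman] arg_cong[of _ _ f])
  also have "t * \<dots> = measure_pmf.expectation (axis_pmf i ?p)
      (\<lambda>n. \<Sum>j\<in>UNIV. (if j = i then t else 0) * bregman (f (incr j n)) (f n))"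
    by (simp add: if_distrib[of "\<lambda>x. x * _"] sum.delta cong: if_cong)
  finally show "Ent (axis_pmf i ?p) f \<le> \<dots> + ?B * t\<^sup>2"
    using \<open>0 < t\<close> by (simp add: mult_left_mono)
qed

text \<open>Split the parameter into \<open>Suc N\<close> equal parts \<open>r / Suc N\<close>. The
  errors add up to a multiple of \<open>1 / Suc N\<close> and vanish in the limit, while the rates
  add up to \<open>r\<close>.\<close>

lemma approx_lsi_axis_poisson:
  fixes i :: "'d::finite"
  assumes "0 < c" "0 < r"
  shows "approx_lsi c C (axis_pmf i (poisson_pmf r)) (\<lambda>j. if j = i then r else 0) 0"
proof -
  let ?B = "(C - c) * (ln C - ln c)"
  \<comment> \<open>The induction starts with one summand, so that every Poisson parameter is
    positive.\<close>
  have step: "approx_lsi c C (axis_pmf i (poisson_pmf (real (Suc N) * t)))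
      (\<lambda>j. if j = i then real (Suc N) * t else 0) (real (Suc N) * (?B * t\<^sup>2))" if "0 < t" for N t
  proof (induction N)
    case 0
    then show ?case using approx_lsi_small_poisson[OF \<open>0 < c\<close> that, of C i] by (simp cong: if_cong)
  next
    case (Suc N)
    have *: "real (Suc (Suc N)) * x = real (Suc N) * x + x" for x
      by (simp add: algebra_simps)
    have "(\<lambda>j. (if j = i then real (Suc N) * t else 0) + (if j = i then t else 0))
        = (\<lambda>j. if j = i then real (Suc (Suc N)) * t else 0)"
      by (intro ext) (simp add: algebra_simps)
    moreover have "convolution (axis_pmf i (poisson_pmf (real (Suc N) * t))) (axis_pmf i (poisson_pmf t))
        = axis_pmf i (poisson_pmf (real (Suc (Suc N)) * t))"
      using that unfolding convolution_axis_pmf * by (subst poisson_pmf_add) auto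
    moreover have "approx_lsi c C
        (convolution (axis_pmf i (poisson_pmf (real (Suc N) * t))) (axis_pmf i (poisson_pmf t)))
        (\<lambda>j. (if j = i then real (Suc N) * t else 0) + (if j = i then t else 0))
        (real (Suc N) * (?B * t\<^sup>2) + ?B * t\<^sup>2)"
      using that by (intro approx_lsi_convolution Suc approx_lsi_small_poisson \<open>0 < c\<close>) auto
    ultimately show ?case
      by (simp only: *)
  qed
  have *: "approx_lsi c C (axis_pmf i (poisson_pmf r)) (\<lambda>j. if j = i then r else 0) (?B * r\<^sup>2 / real (Suc N))" for N
  proof -
    have "real (Suc N) * (r / real (Suc N)) = r"
      and "real (Suc N) * (?B * (r / real (Suc N))\<^sup>2) = ?B * r\<^sup>2 / real (Suc N)"
      by (simp_all add: power2_eq_square)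
    then show ?thesis
      using step[of "r / real (Suc N)" N] \<open>0 < r\<close> by (simp only:) simp
  qed
  show ?thesis
    unfolding approx_lsi_def
  proof (intro allI impI)
    fix f :: "('d \<Rightarrow> nat) \<Rightarrow> real" assume f: "\<forall>n. c \<le> f n \<and> f n \<le> C"
    let ?R = "measure_pmf.expectation (axis_pmf i (poisson_pmf r))
      (\<lambda>n. \<Sum>j\<in>UNIV. (if j = i then r else 0) * bregman (f (incr j n)) (f n))"
    have "(\<lambda>N. ?R + ?B * r\<^sup>2 / real (Suc N)) \<longlonglongrightarrow> ?R + 0"
      by (intro tendsto_add tendsto_const LIMSEQ_Suc[OF lim_const_over_n])
    then show "Ent (axis_pmf i (poisson_pmf r)) f \<le> ?R + 0"
      by (rule LIMSEQ_le_const) (use * f in \<open>auto simp: approx_lsi_def\<close>)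
  qed
qed

lemma approx_lsi_poisson_product:
  assumes "0 < c" "\<forall>i. 0 < m i"
  shows "approx_lsi c C (poisson_product m) m 0"
proof -
  have "approx_lsi c C (Pi_pmf A 0 (\<lambda>i. poisson_pmf (m i))) (\<lambda>j. if j \<in> A then m j else 0) 0" for A
  proof (induction A rule: infinite_finite_induct)
    case empty
    then show ?case by (simp add: approx_lsi_def Ent_def)
  next
    case (insert i A)
    have "Pi_pmf (insert i A) 0 (\<lambda>i. poisson_pmf (m i))
        = convolution (axis_pmf i (poisson_pmf (m i))) (Pi_pmf A 0 (\<lambda>i. poisson_pmf (m i)))"
      unfolding Pi_pmf_insert'[OF insert.hyps] convolution_def axis_pmf_def bind_map_pmf map_pmf_def[of _ "Pi_pmf _ _ _"]
      by (intro bind_pmf_cong refl arg_cong[of _ _ return_pmf])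
        (use insert.hyps set_Pi_pmf_subset[OF insert.hyps(1)] in \<open>fastforce simp: fun_eq_iff\<close>)
    moreover have "(\<lambda>j. if j \<in> insert i A then m j else 0)
        = (\<lambda>j. (if j = i then m i else 0) + (if j \<in> A then m j else 0))"
      using insert.hyps by auto
    ultimately show ?case
      using approx_lsi_convolution[OF \<open>0 < c\<close> _ approx_lsi_axis_poisson[OF \<open>0 < c\<close>] insert.IH] assms(2)
      by (simp add: less_imp_le)
  qed simp
  from this[of UNIV] show ?thesis by (simp add: poisson_product_def)
qed

subsection \<open>Generating functions\<close>

text \<open>Summation by parts: \<mu>(n) times the birth rate is (n_i + 1) \<mu>(n + e_i), and the
  substitution k = n + e_i gives the right-hand side. Downward closedness covers \<mu>(n) = 0, where
  \<mu>(n + e_i) must vanish too.\<close>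

lemma nn_integral_birth_rate:
  assumes "downward_closed (set_pmf \<mu>)"
  shows "(\<integral>\<^sup>+n. ennreal (birth_rate \<mu> i n) * h n \<partial>measure_pmf \<mu>)
    = (\<integral>\<^sup>+n. ennreal (real (n i)) * h (n(i := n i - 1)) \<partial>measure_pmf \<mu>)"
proof -
  define g where "g k = ennreal (pmf \<mu> k) * (ennreal (real (k i)) * h (k(i := k i - 1)))" for k
  have g: "ennreal (pmf \<mu> n) * (ennreal (birth_rate \<mu> i n) * h n) = g (incr i n)" for n
  proof -
    have "pmf \<mu> n * birth_rate \<mu> i n = pmf \<mu> (incr i n) * real (incr i n i)"
    proof (cases "pmf \<mu> n = 0")
      case True
      have "n \<le> incr i n" by (simp add: le_fun_def incr_def)
      then have "pmf \<mu> (incr i n) = 0"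
        using True assms unfolding downward_closed_def by (metis set_pmf_iff)
      then show ?thesis using True by simp
    qed (simp add: birth_rate_def incr_def)
    then have "ennreal (pmf \<mu> n) * ennreal (birth_rate \<mu> i n)
        = ennreal (pmf \<mu> (incr i n)) * ennreal (real (incr i n i))"
      by (simp add: ennreal_mult'[symmetric])
    moreover have "(incr i n)(i := incr i n i - 1) = n"
      by (simp add: incr_def)
    ultimately show ?thesis
      by (simp add: g_def mult.assoc[symmetric])
  qed
  have bij: "bij_betw (incr i) UNIV {k :: 'a \<Rightarrow> nat. 0 < k i}"
  proof (rule bij_betw_byWitness[of _ "\<lambda>k. k(i := k i - 1)"])
  qed (auto simp: incr_def)
  have "(\<integral>\<^sup>+n. ennreal (birth_rate \<mu> i n) * h n \<partial>measure_pmf \<mu>) = (\<integral>\<^sup>+n. g (incr i n) \<partial>count_space UNIV)"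
    by (simp add: nn_integral_measure_pmf g)
  \<comment> \<open>The shift reaches exactly the points with \<open>0 < k i\<close>. At all others
    \<open>g\<close> vanishes through its factor \<open>k i\<close>, so the truncated subtraction
    \<open>k i - 1\<close> does no harm there.\<close>
  also have "\<dots> = (\<integral>\<^sup>+k. g k \<partial>count_space {k. 0 < k i})"
    by (rule nn_integral_bij_count_space[OF bij])
  also have "\<dots> = (\<integral>\<^sup>+k. g k \<partial>count_space UNIV)"
    by (rule nn_integral_count_space_eq) (auto simp: g_def)
  finally show ?thesis by (simp add: nn_integral_measure_pmf g_def)
qed

lemma birth_rate_nonneg [simp]: "0 \<le> birth_rate \<mu> i n"
  by (simp add: birth_rate_def)

lemma has_bochner_integral_birth_rate:
  assumes "downward_closed (set_pmf \<mu>)" and int: "integrable (measure_pmf \<mu>) (\<lambda>n. real (n i))"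
    and g: "\<And>n. 0 \<le> g n \<and> g n \<le> B"
  shows "has_bochner_integral (measure_pmf \<mu>) (\<lambda>n. birth_rate \<mu> i n * g n)
    (measure_pmf.expectation \<mu> (\<lambda>n. real (n i) * g (n(i := n i - 1))))"
proof (rule has_bochner_integral_nn_integral)
  have "integrable (measure_pmf \<mu>) (\<lambda>n. real (n i) * g (n(i := n i - 1)))"
  proof (rule Bochner_Integration.integrable_bound)
    show "integrable (measure_pmf \<mu>) (\<lambda>n. real (n i) * B)" using int by simp
    show "AE n in measure_pmf \<mu>. norm (real (n i) * g (n(i := n i - 1))) \<le> norm (real (n i) * B)"
    proof (rule AE_I2)
      fix n
      have "0 \<le> g (n(i := n i - 1))" "g (n(i := n i - 1)) \<le> B" using g by auto
      then show "norm (real (n i) * g (n(i := n i - 1))) \<le> norm (real (n i) * B)"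
        by (simp add: abs_mult mult_left_mono)
    qed
  qed simp
  then have "(\<integral>\<^sup>+n. ennreal (real (n i) * g (n(i := n i - 1))) \<partial>measure_pmf \<mu>)
      = ennreal (measure_pmf.expectation \<mu> (\<lambda>n. real (n i) * g (n(i := n i - 1))))"
    using g by (intro nn_integral_eq_integral) auto
  then show "(\<integral>\<^sup>+n. ennreal (birth_rate \<mu> i n * g n) \<partial>measure_pmf \<mu>)
      = ennreal (measure_pmf.expectation \<mu> (\<lambda>n. real (n i) * g (n(i := n i - 1))))"
    using g nn_integral_birth_rate[OF assms(1), of i "\<lambda>n. ennreal (g n)"] by (simp add: ennreal_mult)
qed (use g in \<open>auto intro!: integral_nonneg_AE\<close>)

lemma grad_coordinate:
  "grad j (\<lambda>n. \<phi> (n i)) n = (if j = i then \<phi> (Suc (n i)) - \<phi> (n i) else 0)"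
  by (simp add: grad_def incr_def)

text \<open>Only direction \<open>i\<close> contributes to the energy. Its squared gradient is
  bounded, and the mean birth rate is at most the first moment, which is finite.\<close>

lemma dirichlet_domain_coordinate:
  fixes \<phi> :: "nat \<Rightarrow> real" and i :: "'d::finite"
  assumes "downward_closed (set_pmf \<mu>)" "integrable (measure_pmf \<mu>) (\<lambda>n. real (n i))"
    and \<phi>: "\<And>k. \<bar>\<phi> k\<bar> \<le> B"
  shows "(\<lambda>n. \<phi> (n i)) \<in> dirichlet_domain \<mu>"
proof -
  have sq: "\<bar>(\<phi> k - \<phi> l)\<^sup>2\<bar> \<le> (2 * B)\<^sup>2" for k l
  proof -
    have "\<bar>\<phi> k - \<phi> l\<bar> \<le> \<bar>2 * B\<bar>" using \<phi>[of k] \<phi>[of l] by linarith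
    then show ?thesis by (simp only: abs_le_square_iff) simp
  qed
  have "(\<Sum>j\<in>UNIV. birth_rate \<mu> j n * (grad j (\<lambda>n. \<phi> (n i)) n)\<^sup>2)
      = birth_rate \<mu> i n * (\<phi> (Suc (n i)) - \<phi> (n i))\<^sup>2" for n
    by (subst sum.remove[of _ i]) (auto simp: grad_coordinate)
  moreover have "integrable (measure_pmf \<mu>) (\<lambda>n. birth_rate \<mu> i n * (\<phi> (Suc (n i)) - \<phi> (n i))\<^sup>2)"
    using sq has_bochner_integral_birth_rate[OF assms(1,2), of "\<lambda>n. (\<phi> (Suc (n i)) - \<phi> (n i))\<^sup>2" "(2 * B)\<^sup>2"]
    by (auto dest: integrable.intros)
  ultimately have "dirichlet_energy \<mu> (\<lambda>n. \<phi> (n i)) < \<infinity>"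
    by (simp add: dirichlet_energy_def nn_integral_eq_integral less_top)
  moreover have "integrable (measure_pmf \<mu>) (\<lambda>n. (\<phi> (n i))\<^sup>2)"
    using \<phi> by (intro integrable_pmf_bounded[of _ "B\<^sup>2"]) (auto simp: abs_le_square_iff[symmetric] intro: order_trans[OF _ abs_ge_self])
  ultimately show ?thesis
    by (simp add: dirichlet_domain_def square_integrable_def)
qed

text \<open>Test with z to the power n_i, truncated at \<open>N\<close>, then let \<open>N\<close>
  tend to infinity. The truncation matters because the logarithm of the test function must be square
  integrable, while only a first moment of n_i is at hand.\<close>

lemma WLSI1_pgf:
  fixes \<mu> :: "('d::finite \<Rightarrow> nat) pmf"
  assumes \<mu>: "\<mu> \<in> WLSI1" and int: "integrable (measure_pmf \<mu>) (\<lambda>n. real (n i))" and z: "0 < z" "z < 1"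
  defines "G \<equiv> measure_pmf.expectation \<mu> (\<lambda>n. z ^ n i)"
  shows "- (G * ln G) \<le> (1 - z) * measure_pmf.expectation \<mu> (\<lambda>n. real (n i) * z ^ (n i - 1))"
proof -
  let ?E = "measure_pmf.expectation \<mu>"
  let ?D = "?E (\<lambda>n. real (n i) * z ^ (n i - 1))"
  \<comment> \<open>This is \<open>bregman z 1\<close>; by homogeneity the divergence of one step
    from \<open>z ^ k\<close> to \<open>z ^ Suc k\<close> is
    \<open>\<kappa> * z ^ k\<close>.\<close>
  define \<kappa> where "\<kappa> = z * ln z - z + 1"
  have \<kappa>: "0 \<le> \<kappa>"
    using bregman_nonneg[of 1 z] z by (simp add: \<kappa>_def bregman_def)
  have dc: "downward_closed (set_pmf \<mu>)" using \<mu> by (simp add: WLSI1_def)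
  have zb: "0 < z ^ k" "z ^ k \<le> 1" for k using z by (auto simp: power_le_one)
  have intD: "integrable (measure_pmf \<mu>) (\<lambda>n. real (n i) * z ^ (n i - 1))"
    by (rule Bochner_Integration.integrable_bound[OF int]) (use z in \<open>auto simp: power_le_one mult_left_le\<close>)
  define \<phi> where "\<phi> N k = z ^ min k N" for N k
  define F where "F N = ?E (\<lambda>n. \<phi> N (n i))" for N
  define X where "X N = ?E (\<lambda>n. \<phi> N (n i) * ln (\<phi> N (n i)))" for N
  have main: "X N - F N * ln (F N) \<le> \<kappa> * ?D" for N
  proof -
    have "(\<lambda>n. \<phi> N (n i)) \<in> dirichlet_domain \<mu>"
      by (rule dirichlet_domain_coordinate[OF dc int, of _ 1]) (use z in \<open>auto simp: \<phi>_def power_abs power_le_one\<close>)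
    moreover have "(\<lambda>n. ln (\<phi> N (n i))) \<in> dirichlet_domain \<mu>"
      by (rule dirichlet_domain_coordinate[OF dc int, of "\<lambda>k. ln (\<phi> N k)" "real N * \<bar>ln z\<bar>"])
        (use z in \<open>auto simp: \<phi>_def ln_realpow abs_mult intro!: mult_right_mono\<close>)
    ultimately have "(\<lambda>n. \<phi> N (n i)) \<in> admissible \<mu>"
      using zb by (auto simp: admissible_def dirichlet_domain_def \<phi>_def)
    then have "Ent \<mu> (\<lambda>n. \<phi> N (n i))
        \<le> ?E (\<lambda>n. \<Sum>j\<in>UNIV. birth_rate \<mu> j n * Psi (\<phi> N (n i)) (grad j (\<lambda>n. \<phi> N (n i)) n))"
      using \<mu> by (simp add: WLSI1_def)
    also have "(\<lambda>n. \<Sum>j\<in>UNIV. birth_rate \<mu> j n * Psi (\<phi> N (n i)) (grad j (\<lambda>n. \<phi> N (n i)) n))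
        = (\<lambda>n. birth_rate \<mu> i n * (if n i < N then \<kappa> * z ^ n i else 0))"
    proof
      fix n :: "'d \<Rightarrow> nat"
      have "Psi (\<phi> N (n i)) (grad i (\<lambda>n. \<phi> N (n i)) n) = (if n i < N then \<kappa> * z ^ n i else 0)"
        using z unfolding grad_coordinate by (auto simp: \<phi>_def Psi_def \<kappa>_def ln_mult ln_realpow min_def algebra_simps)
      then show "(\<Sum>j\<in>UNIV. birth_rate \<mu> j n * Psi (\<phi> N (n i)) (grad j (\<lambda>n. \<phi> N (n i)) n))
        = birth_rate \<mu> i n * (if n i < N then \<kappa> * z ^ n i else 0)"
        by (subst sum.remove[of _ i]) (auto simp: grad_coordinate Psi_def)
    qed
    also have "?E \<dots> = ?E (\<lambda>n. real (n i) * (if n i - 1 < N then \<kappa> * z ^ (n i - 1) else 0))"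
      using has_bochner_integral_birth_rate[OF dc int, of "\<lambda>n. if n i < N then \<kappa> * z ^ n i else 0" \<kappa>] \<kappa> zb
      by (auto simp: has_bochner_integral_iff mult_left_le zero_le_mult_iff less_imp_le cong: if_cong)
    also have "\<dots> \<le> ?E (\<lambda>n. \<kappa> * (real (n i) * z ^ (n i - 1)))"
    proof (rule integral_mono)
      show "integrable (measure_pmf \<mu>) (\<lambda>n. real (n i) * (if n i - 1 < N then \<kappa> * z ^ (n i - 1) else 0))"
        by (rule Bochner_Integration.integrable_bound[OF integrable_mult_right[OF intD, of \<kappa>]])
          (use \<kappa> z in \<open>auto simp: abs_mult\<close>)
    qed (use intD \<kappa> z in auto)
    finally show ?thesis by (simp add: Ent_def F_def X_def)
  qed
  have \<phi>_lim: "(\<lambda>N. \<phi> N k) \<longlonglongrightarrow> z ^ k" for k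
    by (rule tendsto_eventually) (auto simp: \<phi>_def min_def eventually_sequentially intro: exI[of _ k])
  have F: "F \<longlonglongrightarrow> G"
    unfolding F_def G_def
    by (rule integral_dominated_convergence[where w = "\<lambda>_. 1"]) (use \<phi>_lim z in \<open>auto simp: \<phi>_def power_abs power_le_one\<close>)
  have X: "X \<longlonglongrightarrow> ?E (\<lambda>n. z ^ n i * ln (z ^ n i))"
    unfolding X_def
  proof (rule integral_dominated_convergence[where w = "\<lambda>n. real (n i) * \<bar>ln z\<bar>"])
    show "AE n in measure_pmf \<mu>. norm (\<phi> N (n i) * ln (\<phi> N (n i))) \<le> real (n i) * \<bar>ln z\<bar>" for N
    proof (rule AE_I2)
      fix n
      have "norm (\<phi> N (n i) * ln (\<phi> N (n i))) = z ^ min (n i) N * (real (min (n i) N) * \<bar>ln z\<bar>)"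
        using z by (simp add: \<phi>_def ln_realpow abs_mult)
      also have "\<dots> \<le> 1 * (real (n i) * \<bar>ln z\<bar>)"
        using zb by (intro mult_mono) auto
      finally show "norm (\<phi> N (n i) * ln (\<phi> N (n i))) \<le> real (n i) * \<bar>ln z\<bar>" by simp
    qed
    show "AE n in measure_pmf \<mu>. (\<lambda>N. \<phi> N (n i) * ln (\<phi> N (n i))) \<longlonglongrightarrow> z ^ n i * ln (z ^ n i)"
      using zb by (intro AE_I2 tendsto_intros \<phi>_lim) (metis less_irrefl)
  qed (use int in auto)
  have "0 < G"
    unfolding G_def using z
    by (intro expectation_pos integrable_pmf_bounded[of _ 1]) (auto simp: power_le_one)
  then have "(\<lambda>N. X N - F N * ln (F N)) \<longlonglongrightarrow> ?E (\<lambda>n. z ^ n i * ln (z ^ n i)) - G * ln G"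
    by (intro tendsto_intros X F) auto
  then have "?E (\<lambda>n. z ^ n i * ln (z ^ n i)) - G * ln G \<le> \<kappa> * ?D"
    by (rule LIMSEQ_le_const2) (use main in auto)
  \<comment> \<open>The entropy term thus equals \<open>z * ln z\<close> times \<open>?D\<close>.
    Subtracting it from \<open>\<kappa> * ?D\<close> leaves \<open>(1 - z) * ?D\<close>.\<close>
  moreover have "z ^ n i * ln (z ^ n i) = (z * ln z) * (real (n i) * z ^ (n i - 1))" for n
    using z by (cases "n i") (auto simp: ln_realpow ln_mult algebra_simps)
  ultimately show ?thesis
    using intD by (simp add: \<kappa>_def algebra_simps)
qed

section \<open>Comparison with the Poisson generating function\<close>

lemma expectation_nat_sums:
  fixes f :: "nat \<Rightarrow> real"
  assumes "integrable (measure_pmf p) f"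
  shows "(\<lambda>k. pmf p k * f k) sums measure_pmf.expectation p f"
proof -
  have "integrable (count_space UNIV) (\<lambda>k. pmf p k * f k)"
    using assms unfolding measure_pmf_eq_density by (subst (asm) integrable_density) auto
  then have "(\<lambda>k. pmf p k * f k) sums integral\<^sup>L (count_space UNIV) (\<lambda>k. pmf p k * f k)"
    by (rule sums_integral_count_space_nat)
  then show ?thesis
    unfolding measure_pmf_eq_density by (subst integral_density) auto
qed

text \<open>Termwise differentiation of the power series with coefficients \<open>pmf p\<close>,
  which converges on the open unit interval around 0.\<close>

lemma pgf_has_derivative:
  fixes p :: "nat pmf"
  assumes int: "integrable (measure_pmf p) real" and z: "\<bar>z\<bar> < 1"
  shows "((\<lambda>z. measure_pmf.expectation p (\<lambda>k. z ^ k)) has_field_derivative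
    measure_pmf.expectation p (\<lambda>k. real k * z ^ (k - 1))) (at z)"
proof -
  have sums: "(\<lambda>k. pmf p k * y ^ k) sums measure_pmf.expectation p (\<lambda>k. y ^ k)" if "\<bar>y\<bar> < 1" for y :: real
    using that by (intro expectation_nat_sums integrable_pmf_bounded[of _ 1]) (simp add: power_abs power_le_one)
  have "integrable (measure_pmf p) (\<lambda>k. real k * z ^ (k - 1))"
    by (rule Bochner_Integration.integrable_bound[OF int])
      (use z in \<open>auto simp: abs_mult power_abs power_le_one mult_left_le\<close>)
  then have "(\<lambda>k. pmf p k * (real k * z ^ (k - 1))) sums measure_pmf.expectation p (\<lambda>k. real k * z ^ (k - 1))"
    by (rule expectation_nat_sums)
  then have "(\<lambda>k. diffs (pmf p) k * z ^ k) sums measure_pmf.expectation p (\<lambda>k. real k * z ^ (k - 1))"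
    using sums_Suc_iff[of "\<lambda>k. pmf p k * (real k * z ^ (k - 1))"] by (simp add: diffs_def algebra_simps)
  moreover have "((\<lambda>z. \<Sum>k. pmf p k * z ^ k) has_field_derivative (\<Sum>k. diffs (pmf p) k * z ^ k)) (at z)"
    by (rule termdiffs_strong'[of 1]) (use sums z in \<open>auto intro: sums_summable\<close>)
  ultimately have "((\<lambda>z. \<Sum>k. pmf p k * z ^ k) has_field_derivative
      measure_pmf.expectation p (\<lambda>k. real k * z ^ (k - 1))) (at z)"
    by (simp add: sums_iff)
  moreover have "\<forall>\<^sub>F y in nhds z. (\<Sum>k. pmf p k * y ^ k) = measure_pmf.expectation p (\<lambda>k. y ^ k)"
    by (rule eventually_nhds_in_open[of "{-1<..<1}", THEN eventually_mono])
      (use z in \<open>auto intro!: sums_unique[symmetric] sums\<close>)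
  ultimately show ?thesis
    by (subst DERIV_cong_ev[OF refl, symmetric]) auto
qed

text \<open>The assumed inequality says that \<open>ln (G z) / (1 - z)\<close> has nonnegative
  derivative. Its value at \<open>z\<close> is therefore at most its values near 1, which are
  controlled by minus the mean.\<close>

lemma pgf_le_exp:
  fixes p :: "nat pmf"
  defines "G \<equiv> \<lambda>z :: real. measure_pmf.expectation p (\<lambda>k. z ^ k)"
  assumes int: "integrable (measure_pmf p) real"
    and G': "\<And>z. 0 < z \<Longrightarrow> z < 1 \<Longrightarrow>
      - (G z * ln (G z)) \<le> (1 - z) * measure_pmf.expectation p (\<lambda>k. real k * z ^ (k - 1))"
    and z: "0 < z" "z < 1"
  shows "G z \<le> exp (- (measure_pmf.expectation p real * (1 - z)))"
proof -
  let ?E = "measure_pmf.expectation p"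
  have pos: "0 < G y" if "0 < y" "y < 1" for y
    unfolding G_def using that
    by (intro expectation_pos integrable_pmf_bounded[of _ 1]) (auto simp: power_le_one)
  have mono: "ln (G x) / (1 - x) \<le> ln (G y) / (1 - y)" if "0 < x" "x \<le> y" "y < 1" for x y
  proof (rule DERIV_nonneg_imp_nondecreasing[OF \<open>x \<le> y\<close>])
    fix t assume t: "x \<le> t" "t \<le> y"
    then have t': "0 < t" "t < 1" using that by auto
    let ?G' = "?E (\<lambda>k. real k * t ^ (k - 1))"
    have "(G has_field_derivative ?G') (at t)"
      unfolding G_def using t' by (intro pgf_has_derivative int) auto
    then have "((\<lambda>t. ln (G t) / (1 - t)) has_field_derivative
        (?G' / G t * (1 - t) + ln (G t)) / (1 - t)\<^sup>2) (at t)"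
      using pos[OF t'] t' by (auto intro!: derivative_eq_intros simp: power2_eq_square field_simps)
    moreover have "0 \<le> (?G' / G t * (1 - t) + ln (G t)) / (1 - t)\<^sup>2"
    proof (intro divide_nonneg_nonneg)
      have "0 \<le> ((1 - t) * ?G' + G t * ln (G t)) / G t"
        using G'[OF t'] pos[OF t'] by simp
      then show "0 \<le> ?G' / G t * (1 - t) + ln (G t)"
        using pos[OF t'] by (simp add: field_simps)
    qed simp
    ultimately show "\<exists>D. ((\<lambda>t. ln (G t) / (1 - t)) has_real_derivative D) (at t) \<and> 0 \<le> D"
      by blast
  qed
  \<comment> \<open>A sequence starting at \<open>y 0 = z\<close> and tending to 1 from
    below.\<close>
  define y where "y n = 1 - (1 - z) / real (Suc n)" for n
  have y: "z \<le> y n" "y n < 1" for n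
    using z by (auto simp: y_def field_simps mult_left_le_one_le)
  have "y \<longlonglongrightarrow> 1 - 0"
    unfolding y_def by (intro tendsto_diff tendsto_const LIMSEQ_Suc[OF lim_const_over_n])
  then have y_lim: "y \<longlonglongrightarrow> 1" by simp
  have bound: "ln (G z) / (1 - z) \<le> - ?E (\<lambda>k. \<Sum>j<k. y n ^ j)" for n
  proof -
    have yn: "0 < y n" "y n < 1" using y[of n] z by auto
    have int': "integrable p (\<lambda>k. y n ^ k)"
      using yn by (intro integrable_pmf_bounded[of _ 1]) (simp add: power_le_one)
    have "ln (G z) / (1 - z) \<le> ln (G (y n)) / (1 - y n)"
      using y[of n] z by (intro mono) auto
    \<comment> \<open>After this bound the quotient is minus a difference quotient of
      \<open>G\<close> at 1. Its integrand is a geometric sum with \<open>k\<close> terms in the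
      unit interval, so dominated convergence with majorant \<open>k\<close> yields the
      mean.\<close>
    also have "\<dots> \<le> (G (y n) - 1) / (1 - y n)"
      using yn by (intro divide_right_mono ln_le_minus_one pos) auto
    also have "\<dots> = - ?E (\<lambda>k. (1 - y n ^ k) / (1 - y n))"
      using int' yn by (simp add: G_def field_simps)
    also have "(\<lambda>k. (1 - y n ^ k) / (1 - y n)) = (\<lambda>k. \<Sum>j<k. y n ^ j)"
      using yn by (auto simp: sum_gp_strict)
    finally show ?thesis .
  qed
  have "(\<lambda>n. ?E (\<lambda>k. \<Sum>j<k. y n ^ j)) \<longlonglongrightarrow> ?E (\<lambda>k. real k)"
  proof (rule integral_dominated_convergence[where w = real])
    show "AE k in measure_pmf p. (\<lambda>n. \<Sum>j<k. y n ^ j) \<longlonglongrightarrow> real k"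
    proof (rule AE_I2)
      fix k
      have "(\<lambda>n. \<Sum>j<k. y n ^ j) \<longlonglongrightarrow> (\<Sum>j<k. 1 ^ j)"
        by (intro tendsto_intros y_lim)
      then show "(\<lambda>n. \<Sum>j<k. y n ^ j) \<longlonglongrightarrow> real k" by simp
    qed
    show "AE k in measure_pmf p. norm (\<Sum>j<k. y n ^ j) \<le> real k" for n
    proof (rule AE_I2)
      fix k
      have "0 \<le> y n ^ j" "y n ^ j \<le> 1" for j
        using y[of n] z by (auto simp: power_le_one)
      then have "0 \<le> (\<Sum>j<k. y n ^ j)" "(\<Sum>j<k. y n ^ j) \<le> (\<Sum>j<k. 1)"
        by (intro sum_nonneg sum_mono; blast)+
      then show "norm (\<Sum>j<k. y n ^ j) \<le> real k" by simp
    qed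
  qed (use int in auto)
  then have "ln (G z) / (1 - z) \<le> - ?E real"
    by (intro LIMSEQ_le_const[OF tendsto_minus]) (use bound in auto)
  then have "ln (G z) \<le> - (?E real * (1 - z))"
    using z by (simp add: field_simps)
  then show ?thesis
    using pos[OF z] by (metis exp_le_cancel_iff exp_ln)
qed

subsection \<open>An integral representation of \<open>ln (n!)\<close>\<close>

lemma nn_integral_exp_Ici:
  assumes "0 < r"
  shows "(\<integral>\<^sup>+t. ennreal (exp (- r * t)) * indicator {0..} t \<partial>lborel) = ennreal (1 / r)"
proof -
  have "(\<integral>\<^sup>+t. ennreal (exp (- r * t)) * indicator {0..} t \<partial>lborel)
      = ennreal (0 - (- exp (- r * 0) / r))"
  proof (rule nn_integral_FTC_atLeast)
    show "((\<lambda>t. - exp (- r * t) / r) has_real_derivative exp (- r * t)) (at t)" for t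
      using assms by (auto intro!: derivative_eq_intros)
    have "((\<lambda>t. exp (- (r * t))) \<longlongrightarrow> 0) at_top"
      by (rule filterlim_compose[OF exp_at_bot])
        (use assms in \<open>auto intro!: filterlim_tendsto_pos_mult_at_top[OF tendsto_const] filterlim_ident simp: filterlim_uminus_at_bot\<close>)
    then show "((\<lambda>t. - exp (- r * t) / r) \<longlongrightarrow> 0) at_top"
      using tendsto_divide_zero tendsto_minus by fastforce
  qed auto
  then show ?thesis by simp
qed

text \<open>A Frullani integral, computed by Tonelli from \<open>(1 - e\<^sup>-\<^sup>k\<^sup>t) / t = \<integral>\<^sub>0\<^sup>k e\<^sup>-\<^sup>s\<^sup>t ds\<close>.\<close>

lemma nn_integral_frullani:
  "(\<integral>\<^sup>+t. ennreal ((1 - exp (- t) ^ k) * exp (- t) / t) * indicator {0<..} t \<partial>lborel) = ennreal (ln (real k + 1))"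
proof -
  have inner: "ennreal ((1 - exp (- t) ^ k) * exp (- t) / t)
      = (\<integral>\<^sup>+s. ennreal (exp (- (s + 1) * t)) * indicator {0..real k} s \<partial>lborel)" if "0 < t" for t
  proof -
    have "(\<integral>\<^sup>+s. ennreal (exp (- (s + 1) * t)) * indicator {0..real k} s \<partial>lborel)
        = ennreal (- exp (- (real k + 1) * t) / t - - exp (- (0 + 1) * t) / t)"
      by (rule nn_integral_FTC_Icc)
        (use that in \<open>auto intro!: derivative_eq_intros simp: has_real_derivative_iff_has_vector_derivative[symmetric]\<close>)
    also have "- exp (- (real k + 1) * t) / t - - exp (- (0 + 1) * t) / t
        = (1 - exp (- t) ^ k) * exp (- t) / t"
      using that by (simp add: exp_of_nat_mult[symmetric] exp_add[symmetric] field_simps)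
    finally show ?thesis by simp
  qed
  \<comment> \<open>The indicators of the open and the closed half-line differ only at the null
    point 0.\<close>
  have "(\<integral>\<^sup>+t. ennreal ((1 - exp (- t) ^ k) * exp (- t) / t) * indicator {0<..} t \<partial>lborel)
      = (\<integral>\<^sup>+t. (\<integral>\<^sup>+s. ennreal (exp (- (s + 1) * t)) * indicator {0..real k} s * indicator {0..} t \<partial>lborel) \<partial>lborel)"
    using AE_lborel_singleton[of 0]
    by (intro nn_integral_cong_AE)
      (auto elim!: eventually_mono simp: inner indicator_def nn_integral_multc)
  also have "\<dots> = (\<integral>\<^sup>+s. (\<integral>\<^sup>+t. ennreal (exp (- (s + 1) * t)) * indicator {0..real k} s * indicator {0..} t \<partial>lborel) \<partial>lborel)"
    by (rule lborel_pair.Fubini') measurable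
  also have "\<dots> = (\<integral>\<^sup>+s. (\<integral>\<^sup>+t. ennreal (exp (- (s + 1) * t)) * indicator {0..} t \<partial>lborel) * indicator {0..real k} s \<partial>lborel)"
    by (subst nn_integral_multc[symmetric]) (auto simp: mult_ac intro!: nn_integral_cong)
  also have "\<dots> = (\<integral>\<^sup>+s. ennreal (1 / (s + 1)) * indicator {0..real k} s \<partial>lborel)"
  proof (rule nn_integral_cong)
    fix s
    show "(\<integral>\<^sup>+t. ennreal (exp (- (s + 1) * t)) * indicator {0..} t \<partial>lborel) * indicator {0..real k} s
        = ennreal (1 / (s + 1)) * indicator {0..real k} s"
    proof (cases "s \<in> {0..real k}")
      case True
      then have "0 < s + 1" by simp
      then show ?thesis by (simp only: nn_integral_exp_Ici)
    qed simp
  qed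
  also have "\<dots> = ennreal (ln (real k + 1) - ln (0 + 1))"
    by (rule nn_integral_FTC_Icc)
      (auto intro!: derivative_eq_intros simp: has_real_derivative_iff_has_vector_derivative[symmetric])
  finally show ?thesis by simp
qed

text \<open>With z = exp (- t) the first factor is n (1 - z) - 1 + z ^ n, whose expectation depends
  only on the mean and the generating function at z. The second factor is the mixing density in
  \<open>t\<close>.\<close>

definition ln_fact_kernel :: "nat \<Rightarrow> real \<Rightarrow> real" where
  "ln_fact_kernel n t = (real n * (1 - exp (- t)) - 1 + exp (- t) ^ n) * (exp (- t) / (t * (1 - exp (- t))))"

text \<open>A geometric sum. It exhibits the kernel as a sum of Frullani integrands, whose integrals
  are the logarithms \<open>ln (k + 1)\<close> that add up to \<open>ln (fact n)\<close>.\<close>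

lemma ln_fact_kernel_eq_sum:
  assumes "0 < t"
  shows "ln_fact_kernel n t = (\<Sum>k<n. (1 - exp (- t) ^ k) * exp (- t) / t)"
proof -
  have "1 - exp (- t) \<noteq> 0" using assms by simp
  then have "(\<Sum>k<n. 1 - exp (- t) ^ k) = (real n * (1 - exp (- t)) - 1 + exp (- t) ^ n) / (1 - exp (- t))"
    by (simp add: sum_subtractf sum_gp_strict field_simps)
  then show ?thesis
    by (simp add: ln_fact_kernel_def sum_divide_distrib[symmetric] sum_distrib_right[symmetric])
qed

lemma ln_fact_kernel_nonneg: "0 < t \<Longrightarrow> 0 \<le> ln_fact_kernel n t"
  by (simp add: ln_fact_kernel_eq_sum sum_nonneg power_le_one)

lemma nn_integral_ln_fact_kernel: "(\<integral>\<^sup>+t. ennreal (ln_fact_kernel n t) * indicator {0<..} t \<partial>lborel) = ennreal (ln (fact n))"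
proof -
  have "(\<integral>\<^sup>+t. ennreal (ln_fact_kernel n t) * indicator {0<..} t \<partial>lborel)
      = (\<integral>\<^sup>+t. (\<Sum>k<n. ennreal ((1 - exp (- t) ^ k) * exp (- t) / t) * indicator {0<..} t) \<partial>lborel)"
    by (intro nn_integral_cong)
      (auto simp: indicator_def ln_fact_kernel_eq_sum power_le_one intro!: sum_ennreal[symmetric])
  also have "\<dots> = (\<Sum>k<n. ennreal (ln (real k + 1)))"
    by (subst nn_integral_sum) (auto simp: nn_integral_frullani)
  also have "\<dots> = ennreal (\<Sum>k<n. ln (real k + 1))"
    by (rule sum_ennreal) simp
  also have "(\<Sum>k<n. ln (real k + 1)) = ln (fact n)"
    by (induction n) (simp_all add: ln_mult add.commute)
  finally show ?thesis .
qed

section \<open>Comparing expectations of \<open>ln (fact k)\<close>\<close>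

lemma nn_integral_nat_pmf: "(\<integral>\<^sup>+k. f k \<partial>measure_pmf p) = (\<Sum>k. ennreal (pmf p k) * f k)"
  for p :: "nat pmf"
  by (simp add: nn_integral_measure_pmf nn_integral_count_space_nat)

text \<open>Tonelli moves the expectation inside the integral over \<open>t\<close>. There the equal
  means cancel, and the inequality of generating functions at \<open>exp (- t)\<close> remains. The
  integrals are nonnegative extended ones, so either side may be infinite.\<close>

lemma nn_integral_ln_fact_mono:
  fixes p q :: "nat pmf"
  assumes p: "integrable (measure_pmf p) real" and q: "integrable (measure_pmf q) real"
    and mean: "measure_pmf.expectation p real = measure_pmf.expectation q real"
    and pgf: "\<And>z :: real. 0 < z \<Longrightarrow> z < 1 \<Longrightarrow>
      measure_pmf.expectation p (\<lambda>k. z ^ k) \<le> measure_pmf.expectation q (\<lambda>k. z ^ k)"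
  shows "(\<integral>\<^sup>+k. ennreal (ln (fact k)) \<partial>measure_pmf p) \<le> (\<integral>\<^sup>+k. ennreal (ln (fact k)) \<partial>measure_pmf q)"
proof -
  have swap: "(\<integral>\<^sup>+k. ennreal (ln (fact k)) \<partial>measure_pmf r)
      = (\<integral>\<^sup>+t. (\<integral>\<^sup>+k. ennreal (ln_fact_kernel k t) \<partial>measure_pmf r) * indicator {0<..} t \<partial>lborel)" for r
  proof -
    have "(\<integral>\<^sup>+k. ennreal (ln (fact k)) \<partial>measure_pmf r)
        = (\<Sum>k. \<integral>\<^sup>+t. ennreal (pmf r k) * (ennreal (ln_fact_kernel k t) * indicator {0<..} t) \<partial>lborel)"
      by (simp add: nn_integral_nat_pmf nn_integral_ln_fact_kernel[symmetric] nn_integral_cmult ln_fact_kernel_def)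
    also have "\<dots> = (\<integral>\<^sup>+t. (\<Sum>k. ennreal (pmf r k) * (ennreal (ln_fact_kernel k t) * indicator {0<..} t)) \<partial>lborel)"
      by (rule nn_integral_suminf[symmetric]) (simp add: ln_fact_kernel_def)
    finally show ?thesis
      by (simp add: nn_integral_nat_pmf mult.assoc[symmetric])
  qed
  have inner: "(\<integral>\<^sup>+k. ennreal (ln_fact_kernel k t) \<partial>measure_pmf r)
      = ennreal ((measure_pmf.expectation r real * (1 - exp (- t)) - 1
          + measure_pmf.expectation r (\<lambda>k. exp (- t) ^ k)) * (exp (- t) / (t * (1 - exp (- t)))))"
    if "0 < t" "integrable (measure_pmf r) real" for r t
  proof -
    have int: "integrable (measure_pmf r) (\<lambda>k. exp (- t) ^ k)"
      using \<open>0 < t\<close> by (intro integrable_pmf_bounded[of _ 1]) (simp add: power_le_one)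
    then have "integrable (measure_pmf r) (\<lambda>k. ln_fact_kernel k t)"
      unfolding ln_fact_kernel_def using that by simp
    then have "(\<integral>\<^sup>+k. ennreal (ln_fact_kernel k t) \<partial>measure_pmf r) = ennreal (measure_pmf.expectation r (\<lambda>k. ln_fact_kernel k t))"
      using ln_fact_kernel_nonneg[OF \<open>0 < t\<close>] by (intro nn_integral_eq_integral) auto
    then show ?thesis
      unfolding ln_fact_kernel_def using that int by simp
  qed
  show ?thesis
    unfolding swap
  proof (rule nn_integral_mono)
    fix t :: real
    show "(\<integral>\<^sup>+k. ennreal (ln_fact_kernel k t) \<partial>measure_pmf p) * indicator {0<..} t
        \<le> (\<integral>\<^sup>+k. ennreal (ln_fact_kernel k t) \<partial>measure_pmf q) * indicator {0<..} t"
    proof (cases "0 < t")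
      case True
      then show ?thesis
        unfolding inner[OF True p] inner[OF True q] mean
        by (intro mult_right_mono ennreal_leI add_mono order_refl pgf) auto
    qed (simp add: indicator_def)
  qed
qed

lemma poisson_pgf:
  assumes "0 < r" "0 < z" "z < 1"
  shows "measure_pmf.expectation (poisson_pmf r) (\<lambda>k. z ^ k) = exp (- (r * (1 - z)))"
proof -
  have "(\<lambda>k. pmf (poisson_pmf r) k * z ^ k) sums measure_pmf.expectation (poisson_pmf r) (\<lambda>k. z ^ k)"
    using assms by (intro expectation_nat_sums integrable_pmf_bounded[of _ 1]) (simp add: power_le_one)
  moreover have "(\<lambda>k. exp (- r) * ((r * z) ^ k /\<^sub>R fact k)) sums (exp (- r) * exp (r * z))"
    by (intro sums_mult exp_converges)
  ultimately have "measure_pmf.expectation (poisson_pmf r) (\<lambda>k. z ^ k) = exp (- r) * exp (r * z)"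
    using assms by (intro sums_unique2) (auto simp: field_simps power_mult_distrib)
  then show ?thesis by (simp add: exp_add[symmetric] algebra_simps)
qed

subsection \<open>Poisson products\<close>

lemma pmf_poisson_product:
  assumes "\<forall>i. 0 < m i"
  shows "pmf (poisson_product m) n = (\<Prod>i\<in>UNIV. m i ^ n i / fact (n i) * exp (- m i))"
  unfolding poisson_product_def using assms by (subst pmf_Pi') (auto intro!: prod.cong)

lemma pmf_poisson_product_pos:
  assumes "\<forall>i. 0 < m i"
  shows "0 < pmf (poisson_product m) n"
  using assms by (auto simp: pmf_poisson_product intro!: prod_pos)

text \<open>Constant rates make the energy in \<open>WLSI1\<close> the one that
  \<open>approx_lsi\<close> uses with weights \<open>m\<close>.\<close>

lemma birth_rate_poisson_product:
  assumes "\<forall>i. 0 < m i"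
  shows "birth_rate (poisson_product m) i n = m i"
proof -
  let ?f = "\<lambda>n j. m j ^ n j / fact (n j) * exp (- m j)"
  have split: "pmf (poisson_product m) k = ?f k i * (\<Prod>j\<in>UNIV - {i}. ?f k j)" for k
    unfolding pmf_poisson_product[OF assms] by (rule prod.remove) auto
  have "(\<Prod>j\<in>UNIV - {i}. ?f (incr i n) j) = (\<Prod>j\<in>UNIV - {i}. ?f n j)"
    by (rule prod.cong) (auto simp: incr_def)
  moreover have "(\<Prod>j\<in>UNIV - {i}. ?f n j) \<noteq> 0"
    using assms by (auto simp: less_imp_neq[THEN not_sym])
  moreover have "?f n i \<noteq> 0"
    using assms[rule_format, of i] by auto
  moreover have "(real (n i) + 1) * ?f (incr i n) i = m i * ?f n i"
  proof -
    have "(real (n i) + 1) * (x / ((real (n i) + 1) * y)) = x / y" for x y :: real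
      by simp
    from this[of "m i * m i ^ n i" "fact (n i)"] show ?thesis
      by (simp add: incr_def add.commute mult.commute)
  qed
  ultimately show ?thesis
    unfolding birth_rate_def split by (simp only: mult.assoc[symmetric]) simp
qed

lemma set_pmf_poisson_product:
  assumes "\<forall>i. 0 < m i"
  shows "set_pmf (poisson_product m) = UNIV"
  using pmf_poisson_product_pos[OF assms] by (auto simp: set_pmf_iff less_imp_neq[THEN not_sym])

lemma downward_closed_poisson_product:
  assumes "\<forall>i. 0 < m i"
  shows "downward_closed (set_pmf (poisson_product m))"
  by (simp add: set_pmf_poisson_product[OF assms] downward_closed_def)

text \<open>With constant birth rates, \<open>nn_integral_birth_rate\<close> is the Stein-Chen
  identity E[n_i h(n - e_i)] = m_i E[h(n)]; take h = 1 and h(n) = 1 + n_i.\<close>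

lemma poisson_product_moments:
  assumes "\<forall>i. 0 < m i"
  shows "has_bochner_integral (measure_pmf (poisson_product m)) (\<lambda>n. real (n i)) (m i)"
    and "integrable (measure_pmf (poisson_product m)) (\<lambda>n. (real (n i))\<^sup>2)"
proof -
  note rec = nn_integral_birth_rate[OF downward_closed_poisson_product[OF assms], of i, symmetric,
      unfolded birth_rate_poisson_product[OF assms]]
  have 1: "(\<integral>\<^sup>+n. ennreal (real (n i)) \<partial>measure_pmf (poisson_product m)) = ennreal (m i)"
    using rec[of "\<lambda>_. 1"] by simp
  then show "has_bochner_integral (measure_pmf (poisson_product m)) (\<lambda>n. real (n i)) (m i)"
    using assms[rule_format, of i] by (intro has_bochner_integral_nn_integral) auto
  have "ennreal ((real (n i))\<^sup>2) = ennreal (real (n i)) * ennreal (1 + real ((n(i := n i - 1)) i))" for n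
    by (cases "n i") (auto simp: ennreal_mult'[symmetric] power2_eq_square simp del: ennreal_plus)
  then have "(\<integral>\<^sup>+n. ennreal ((real (n i))\<^sup>2) \<partial>measure_pmf (poisson_product m))
      = (\<integral>\<^sup>+n. ennreal (m i) * ennreal (1 + real (n i)) \<partial>measure_pmf (poisson_product m))"
    using rec[of "\<lambda>n. ennreal (1 + real (n i))"] by simp
  also have "\<dots> < \<infinity>"
    using 1 assms by (simp add: nn_integral_cmult nn_integral_add ennreal_mult_less_top)
  finally show "integrable (measure_pmf (poisson_product m)) (\<lambda>n. (real (n i))\<^sup>2)"
    by (intro integrableI_bounded) auto
qed

lemma has_mean_poisson_product:
  assumes "\<forall>i. 0 < m i"
  shows "has_mean (poisson_product m) m"
  using poisson_product_moments(1)[OF assms] by (simp add: has_mean_def has_bochner_integral_iff)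

section \<open>Truncating test functions, and membership of the Poisson product\<close>

definition clamp_pos :: "nat \<Rightarrow> real \<Rightarrow> real" where
  "clamp_pos N x = max (1 / real (Suc N)) (min x (real (Suc N)))"

lemma clamp_pos_bounds: "1 / real (Suc N) \<le> clamp_pos N x" "clamp_pos N x \<le> real (Suc N)"
  by (auto simp: clamp_pos_def field_simps intro: order_trans[of _ 1])

lemma clamp_pos_pos: "0 < clamp_pos N x"
  by (rule less_le_trans[OF _ clamp_pos_bounds(1)]) simp

lemma clamp_pos_le: "0 < x \<Longrightarrow> clamp_pos N x \<le> max 1 x"
  by (auto simp: clamp_pos_def intro: order_trans[of _ 1])

lemma clamp_pos_contraction: "\<bar>clamp_pos N x - clamp_pos N y\<bar> \<le> \<bar>x - y\<bar>"
  by (auto simp: clamp_pos_def max_def min_def)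

text \<open>The logarithm is increasing, so it turns the clamp into a clamp between the logarithms
  of the bounds, again a contraction.\<close>

lemma ln_clamp_pos_contraction:
  assumes "0 < x" "0 < y"
  shows "\<bar>ln (clamp_pos N x) - ln (clamp_pos N y)\<bar> \<le> \<bar>ln x - ln y\<bar>"
proof -
  have ln_clamp: "ln (clamp_pos N x) = max (ln (1 / real (Suc N))) (min (ln x) (ln (real (Suc N))))"
    if "0 < x" for x
    unfolding clamp_pos_def max_def min_def using that by (auto simp del: of_nat_Suc)
  have "\<bar>max a (min s b) - max a (min t b)\<bar> \<le> \<bar>s - t\<bar>" for a b s t :: real
    by (auto simp: max_def min_def)
  then show ?thesis by (simp only: ln_clamp assms)
qed

lemma eventually_clamp_pos_eq:
  assumes "0 < x"
  shows "\<forall>\<^sub>F N in sequentially. clamp_pos N x = x"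
proof -
  have "\<forall>\<^sub>F N in sequentially. x < real (Suc N)" "\<forall>\<^sub>F N in sequentially. 1 / x < real (Suc N)"
    using filterlim_at_top_dense[THEN iffD1, OF filterlim_compose[OF filterlim_real_sequentially filterlim_Suc]]
    by blast+
  then show ?thesis
    by eventually_elim (use assms in \<open>auto simp: clamp_pos_def field_simps\<close>)
qed

lemma abs_mult_ln_le_square:
  fixes x :: real
  assumes "0 < x"
  shows "\<bar>x * ln x\<bar> \<le> 1 + x\<^sup>2"
proof -
  have "x * ln x \<le> x * (x - 1)" "x * ln (1 / x) \<le> x * (1 / x - 1)"
    using assms by (intro mult_left_mono ln_le_minus_one; simp)+
  then show ?thesis
    using assms by (auto simp: ln_div algebra_simps power2_eq_square intro!: abs_leI; smt (verit) zero_le_square)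
qed

text \<open>A majorant independent of \<open>N\<close>: clamping shrinks the increments of both
  \<open>f\<close> and \<open>ln f\<close>, and admissibility makes the squares of these increments
  integrable.\<close>

lemma abs_bregman_clamp_pos_le:
  assumes "0 < a" "0 < b"
  shows "\<bar>bregman (clamp_pos N b) (clamp_pos N a)\<bar> \<le> (b - a)\<^sup>2 + (ln b - ln a)\<^sup>2"
proof -
  let ?b = "clamp_pos N b" and ?a = "clamp_pos N a"
  have "\<bar>bregman ?b ?a\<bar> \<le> \<bar>?b - ?a\<bar> * \<bar>ln ?b - ln ?a\<bar>"
    using bregman_nonneg[OF clamp_pos_pos clamp_pos_pos, of N b N a]
      bregman_le[OF clamp_pos_pos clamp_pos_pos, of N b N a]
    by (metis abs_ge_self abs_mult abs_of_nonneg order_trans)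
  also have "\<dots> \<le> \<bar>b - a\<bar> * \<bar>ln b - ln a\<bar>"
    by (intro mult_mono clamp_pos_contraction ln_clamp_pos_contraction assms) auto
  also have "\<dots> \<le> (b - a)\<^sup>2 + (ln b - ln a)\<^sup>2"
    using sum_squares_bound[of "\<bar>b - a\<bar>" "\<bar>ln b - ln a\<bar>"]
      mult_nonneg_nonneg[of "\<bar>b - a\<bar>" "\<bar>ln b - ln a\<bar>"]
    unfolding power2_abs by linarith
  finally show ?thesis .
qed

text \<open>Each clamped function is bounded away from 0 and infinity, so
  \<open>approx_lsi_poisson_product\<close> applies with error 0. Dominated convergence passes to
  the limit on both sides.\<close>

lemma poisson_product_mem_WLSI1:
  fixes m :: "'d::finite \<Rightarrow> real"
  assumes m: "\<forall>i. 0 < m i"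
  shows "poisson_product m \<in> WLSI1"
proof -
  let ?\<pi> = "poisson_product m"
  let ?E = "measure_pmf.expectation ?\<pi>"
  have m': "0 \<le> m i" for i using m by (simp add: less_imp_le)
  have "Ent ?\<pi> f \<le> ?E (\<lambda>n. \<Sum>i\<in>UNIV. m i * bregman (f (incr i n)) (f n))" if "f \<in> admissible ?\<pi>" for f
  proof -
    have pos: "0 < f n" for n
      using that set_pmf_poisson_product[OF m] by (auto simp: admissible_def)
    have f2: "integrable ?\<pi> (\<lambda>n. (f n)\<^sup>2)"
      using that by (simp add: admissible_def square_integrable_def)
    have energy: "integrable ?\<pi> (\<lambda>n. \<Sum>i\<in>UNIV. m i * (grad i g n)\<^sup>2)" if "g \<in> dirichlet_domain ?\<pi>" for g
      using that m' by (intro integrableI_bounded)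
        (auto simp: dirichlet_domain_def dirichlet_energy_def birth_rate_poisson_product[OF m] sum_nonneg)
    have dom: "integrable ?\<pi> (\<lambda>n. (\<Sum>i\<in>UNIV. m i * (grad i f n)\<^sup>2) + (\<Sum>i\<in>UNIV. m i * (grad i (\<lambda>n. ln (f n)) n)\<^sup>2))"
      using that by (intro Bochner_Integration.integrable_add energy) (auto simp: admissible_def)
    define F where "F N n = clamp_pos N (f n)" for N n
    have Fpos: "0 < F N n" for N n
      by (simp add: F_def clamp_pos_pos)
    have F_ev: "\<forall>\<^sub>F N in sequentially. F N n = f n" for n
      unfolding F_def by (rule eventually_clamp_pos_eq[OF pos])
    have F_le: "F N n \<le> max 1 (f n)" for N n
      unfolding F_def by (rule clamp_pos_le[OF pos])
    have "(\<lambda>N. ?E (F N)) \<longlonglongrightarrow> ?E f"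
    proof (rule integral_dominated_convergence[where w = "\<lambda>n. 1 + (f n)\<^sup>2"])
      show "AE n in ?\<pi>. norm (F N n) \<le> 1 + (f n)\<^sup>2" for N
      proof (rule AE_I2)
        fix n
        have "max 1 (f n) \<le> 1 + (f n)\<^sup>2"
          using sum_squares_bound[of 1 "f n"] pos[of n] by simp
        then have "F N n \<le> 1 + (f n)\<^sup>2"
          by (rule order_trans[OF F_le])
        then show "norm (F N n) \<le> 1 + (f n)\<^sup>2"
          using Fpos[of N n] by simp
      qed
      show "AE n in ?\<pi>. (\<lambda>N. F N n) \<longlonglongrightarrow> f n"
        by (intro AE_I2 tendsto_eventually F_ev)
    qed (use f2 in auto)
    moreover have "(\<lambda>N. ?E (\<lambda>n. F N n * ln (F N n))) \<longlonglongrightarrow> ?E (\<lambda>n. f n * ln (f n))"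
    proof (rule integral_dominated_convergence[where w = "\<lambda>n. 2 + (f n)\<^sup>2"])
      show "AE n in ?\<pi>. norm (F N n * ln (F N n)) \<le> 2 + (f n)\<^sup>2" for N
      proof (rule AE_I2)
        fix n
        have "(F N n)\<^sup>2 \<le> (max 1 (f n))\<^sup>2"
          using F_le Fpos by (intro power_mono) (auto intro: less_imp_le)
        also have "\<dots> \<le> 1 + (f n)\<^sup>2"
          by (auto simp: max_def)
        finally show "norm (F N n * ln (F N n)) \<le> 2 + (f n)\<^sup>2"
          using abs_mult_ln_le_square[OF Fpos, of N n] by simp
      qed
      show "AE n in ?\<pi>. (\<lambda>N. F N n * ln (F N n)) \<longlonglongrightarrow> f n * ln (f n)"
      proof (intro AE_I2 tendsto_eventually)
        fix n
        show "\<forall>\<^sub>F N in sequentially. F N n * ln (F N n) = f n * ln (f n)"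
          using F_ev[of n] by eventually_elim simp
      qed
    qed (use f2 in auto)
    moreover have "0 < ?E f"
    proof -
      have "integrable ?\<pi> f"
      proof (rule Bochner_Integration.integrable_bound[where f = "\<lambda>n. 1 + (f n)\<^sup>2"])
        show "AE n in ?\<pi>. norm (f n) \<le> norm (1 + (f n)\<^sup>2)"
        proof (rule AE_I2)
          fix n show "norm (f n) \<le> norm (1 + (f n)\<^sup>2)"
            using sum_squares_bound[of 1 "f n"] pos[of n] by simp
        qed
      qed (use f2 in auto)
      then show ?thesis using pos by (rule expectation_pos)
    qed
    ultimately have Ent_lim: "(\<lambda>N. Ent ?\<pi> (F N)) \<longlonglongrightarrow> Ent ?\<pi> f"
      unfolding Ent_def by (intro tendsto_intros) auto
    have lim: "(\<lambda>N. ?E (\<lambda>n. \<Sum>i\<in>UNIV. m i * bregman (F N (incr i n)) (F N n)))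
        \<longlonglongrightarrow> ?E (\<lambda>n. \<Sum>i\<in>UNIV. m i * bregman (f (incr i n)) (f n))"
    proof (rule integral_dominated_convergence[OF _ _ dom])
      show "AE n in ?\<pi>. norm (\<Sum>i\<in>UNIV. m i * bregman (F N (incr i n)) (F N n))
          \<le> (\<Sum>i\<in>UNIV. m i * (grad i f n)\<^sup>2) + (\<Sum>i\<in>UNIV. m i * (grad i (\<lambda>n. ln (f n)) n)\<^sup>2)" for N
      proof (rule AE_I2)
        fix n
        have "norm (\<Sum>i\<in>UNIV. m i * bregman (F N (incr i n)) (F N n))
            \<le> (\<Sum>i\<in>UNIV. \<bar>m i * bregman (F N (incr i n)) (F N n)\<bar>)"
          by simp
        also have "\<dots> \<le> (\<Sum>i\<in>UNIV. m i * ((grad i f n)\<^sup>2 + (grad i (\<lambda>n. ln (f n)) n)\<^sup>2))"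
          unfolding F_def grad_def abs_mult abs_of_nonneg[OF m']
          by (intro sum_mono mult_left_mono abs_bregman_clamp_pos_le pos m')
        finally show "norm (\<Sum>i\<in>UNIV. m i * bregman (F N (incr i n)) (F N n))
            \<le> (\<Sum>i\<in>UNIV. m i * (grad i f n)\<^sup>2) + (\<Sum>i\<in>UNIV. m i * (grad i (\<lambda>n. ln (f n)) n)\<^sup>2)"
          by (simp add: sum.distrib distrib_left)
      qed
      show "AE n in ?\<pi>. (\<lambda>N. \<Sum>i\<in>UNIV. m i * bregman (F N (incr i n)) (F N n))
          \<longlonglongrightarrow> (\<Sum>i\<in>UNIV. m i * bregman (f (incr i n)) (f n))"
      proof (intro AE_I2 tendsto_sum tendsto_mult tendsto_const tendsto_eventually)
        fix n i
        show "\<forall>\<^sub>F N in sequentially. bregman (F N (incr i n)) (F N n) = bregman (f (incr i n)) (f n)"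
          using F_ev[of n] F_ev[of "incr i n"] by eventually_elim simp
      qed
    qed auto
    have "Ent ?\<pi> (F N) \<le> ?E (\<lambda>n. \<Sum>i\<in>UNIV. m i * bregman (F N (incr i n)) (F N n))" for N
    proof -
      have "approx_lsi (1 / real (Suc N)) (real (Suc N)) ?\<pi> m 0"
        by (intro approx_lsi_poisson_product m) simp
      moreover have "\<forall>n. 1 / real (Suc N) \<le> F N n \<and> F N n \<le> real (Suc N)"
        unfolding F_def using clamp_pos_bounds by blast
      ultimately show ?thesis
        by (simp add: approx_lsi_def)
    qed
    then show ?thesis
      by (intro LIMSEQ_le[OF Ent_lim lim]) auto
  qed
  then show ?thesis
    using downward_closed_poisson_product[OF m]
    by (simp add: WLSI1_def Psi_grad birth_rate_poisson_product[OF m])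
qed

subsection \<open>Entropy\<close>

text \<open>Connects Bochner expectations with the unordered sums over the support that define the
  entropies.\<close>

lemma pmf_mult_has_sum:
  fixes g :: "'a \<Rightarrow> real"
  assumes "integrable (measure_pmf p) g"
  shows "((\<lambda>x. pmf p x * g x) has_sum measure_pmf.expectation p g) (set_pmf p)"
proof -
  let ?h = "\<lambda>x. pmf p x * g x"
  have int: "integrable (count_space UNIV) ?h"
    using assms unfolding measure_pmf_eq_density by (subst (asm) integrable_density) auto
  then have "Infinite_Set_Sum.abs_summable_on ?h UNIV"
    by (simp add: Infinite_Set_Sum.abs_summable_on_def)
  then have "?h summable_on UNIV" and eq: "infsum ?h UNIV = infsetsum ?h UNIV"
    by (auto simp: abs_summable_equivalent[symmetric] infsetsum_infsum intro: abs_summable_summable)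
  moreover have "infsetsum ?h UNIV = measure_pmf.expectation p g"
    unfolding infsetsum_def measure_pmf_eq_density by (subst integral_density) auto
  ultimately have "(?h has_sum measure_pmf.expectation p g) UNIV"
    by (metis has_sum_infsum)
  then show ?thesis
    by (subst has_sum_cong_neutral[of UNIV _ _ ?h]) (auto simp: set_pmf_iff)
qed

lemma has_sum_ereal:
  assumes "(f has_sum s) A"
  shows "((\<lambda>x. ereal (f x)) has_sum ereal s) A"
proof -
  have "sum (\<lambda>x. ereal (f x)) = (\<lambda>F. ereal (sum f F))"
    by (rule ext) simp
  then show ?thesis
    using assms by (simp add: has_sum_def)
qed

lemma has_sum_diff:
  fixes f g :: "'a \<Rightarrow> real"
  assumes "(f has_sum a) A" "(g has_sum b) A"
  shows "((\<lambda>x. f x - g x) has_sum (a - b)) A"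
  using has_sum_add[OF assms(1) has_sum_uminusI[OF assms(2)]] by simp

lemma bregman_eq_0_iff:
  assumes "0 < a" "0 < b"
  shows "bregman b a = 0 \<longleftrightarrow> b = a"
proof
  assume "bregman b a = 0"
  then have "ln (a / b) = a / b - 1"
    using assms by (simp add: bregman_def ln_div field_simps)
  then show "b = a"
    using ln_eq_minus_one[of "a / b"] assms by simp
qed simp

text \<open>Here \<open>v\<close> is the cross entropy. Summing
  \<open>bregman (pmf \<mu> n) (pmf \<nu> n)\<close> over the support of \<open>\<mu>\<close> gives
  \<open>v - 1 + s - h\<close>, where \<open>s\<close> is the mass that \<open>\<nu>\<close> gives
  to this support. The summands are nonnegative and \<open>s \<le> 1\<close>, hence
  \<open>h \<le> v\<close>; equality forces every summand to vanish.\<close>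

lemma gibbs:
  fixes \<mu> \<nu> :: "'a pmf"
  assumes pos: "\<And>n. 0 < pmf \<nu> n" and int: "integrable (measure_pmf \<mu>) (\<lambda>n. - ln (pmf \<nu> n))"
  defines "v \<equiv> measure_pmf.expectation \<mu> (\<lambda>n. - ln (pmf \<nu> n))"
  obtains h where "shannon_entropy \<mu> = ereal h" "relative_entropy \<mu> \<nu> = ereal (v - h)"
    "h \<le> v" "h = v \<Longrightarrow> \<mu> = \<nu>"
proof -
  let ?S = "set_pmf \<mu>"
  let ?V = "\<lambda>n. - ln (pmf \<nu> n)"
  have V: "((\<lambda>n. pmf \<mu> n * ?V n) has_sum v) ?S"
    unfolding v_def by (rule pmf_mult_has_sum[OF int])
  have one: "(pmf \<mu> has_sum 1) ?S"
    using pmf_mult_has_sum[of \<mu> "\<lambda>_. 1"] by simp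
  define s where "s = infsum (pmf \<nu>) ?S"
  have \<nu>: "set_pmf \<nu> = UNIV"
    using pos by (auto simp: set_pmf_iff less_imp_neq[THEN not_sym])
  have all: "(pmf \<nu> has_sum 1) UNIV"
    using pmf_mult_has_sum[of \<nu> "\<lambda>_. 1"] by (simp add: \<nu>)
  then have "pmf \<nu> summable_on ?S"
    by (rule summable_on_subset[OF has_sum_imp_summable]) simp
  then have s: "(pmf \<nu> has_sum s) ?S"
    by (simp add: s_def)
  have "s \<le> 1"
    by (rule has_sum_mono'[OF s all]) auto
  have pos': "0 < pmf \<mu> n" if "n \<in> ?S" for n
    using that by (rule pmf_positive)
  have breg: "bregman (pmf \<mu> n) (pmf \<nu> n) = pmf \<mu> n * ?V n - pmf \<mu> n + pmf \<nu> n - - (pmf \<mu> n * ln (pmf \<mu> n))" for n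
    by (simp add: bregman_def)
  have dom: "((\<lambda>n. pmf \<mu> n * ?V n - pmf \<mu> n + pmf \<nu> n) has_sum (v - 1 + s)) ?S"
    by (intro has_sum_add has_sum_diff V one s)
  \<comment> \<open>Finiteness of the entropy comes from nonnegativity of the divergence, which
    bounds each entropy term by a summable one.\<close>
  have "(\<lambda>n. - (pmf \<mu> n * ln (pmf \<mu> n))) summable_on ?S"
  proof (rule summable_on_comparison_test[OF has_sum_imp_summable[OF dom]])
    fix n assume "n \<in> ?S"
    show "- (pmf \<mu> n * ln (pmf \<mu> n)) \<le> pmf \<mu> n * ?V n - pmf \<mu> n + pmf \<nu> n"
      using bregman_nonneg[OF pos pos'[OF \<open>n \<in> ?S\<close>], of n] unfolding breg by simp
    show "0 \<le> - (pmf \<mu> n * ln (pmf \<mu> n))"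
      using pos'[OF \<open>n \<in> ?S\<close>] pmf_le_1[of \<mu> n] by (simp add: mult_le_0_iff)
  qed
  then obtain h where h: "((\<lambda>n. - (pmf \<mu> n * ln (pmf \<mu> n))) has_sum h) ?S"
    by (auto simp: summable_on_def)
  have D: "((\<lambda>n. bregman (pmf \<mu> n) (pmf \<nu> n)) has_sum (v - 1 + s - h)) ?S"
    unfolding breg by (rule has_sum_diff[OF dom h])
  have D0: "0 \<le> bregman (pmf \<mu> n) (pmf \<nu> n)" if "n \<in> ?S" for n
    by (rule bregman_nonneg[OF pos pos'[OF that]])
  show thesis
  proof (rule that[of h])
    show "shannon_entropy \<mu> = ereal h"
      unfolding shannon_entropy_def by (rule infsumI[OF has_sum_ereal[OF h]])
    have "((\<lambda>n. pmf \<mu> n * ln (pmf \<mu> n / pmf \<nu> n)) has_sum (v - h)) ?S"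
      by (rule has_sum_cong[THEN iffD1, OF _ has_sum_diff[OF V h]])
        (use pos[THEN less_imp_neq, THEN not_sym] in \<open>simp add: ln_div set_pmf_iff algebra_simps\<close>)
    from infsumI[OF has_sum_ereal[OF this]] show "relative_entropy \<mu> \<nu> = ereal (v - h)"
      unfolding relative_entropy_def using pos by (simp add: less_imp_neq[THEN not_sym])
    have "0 \<le> v - 1 + s - h"
      by (rule has_sum_nonneg[OF D D0])
    then show "h \<le> v" using \<open>s \<le> 1\<close> by simp
    show "\<mu> = \<nu>" if "h = v"
    proof (rule ccontr)
      assume "\<mu> \<noteq> \<nu>"
      then obtain n where n: "pmf \<nu> n < pmf \<mu> n"
        using pmf_neq_exists_less by metis
      then have "n \<in> ?S"
        using pos[of n] by (simp add: set_pmf_iff)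
      then have "bregman (pmf \<mu> n) (pmf \<nu> n) = 0"
        using \<open>s \<le> 1\<close> that by (intro nonneg_has_sum_le_0D[OF D _ D0]) auto
      then show False
        using bregman_eq_0_iff[OF pos pos'[OF \<open>n \<in> ?S\<close>]] n by simp
    qed
  qed
qed

section \<open>Cross entropy relative to the Poisson product\<close>

lemma ln_pmf_poisson_product:
  assumes "\<forall>i. 0 < m i"
  shows "- ln (pmf (poisson_product m) n) = (\<Sum>i\<in>UNIV. m i - real (n i) * ln (m i) + ln (fact (n i)))"
proof -
  have "ln (pmf (poisson_product m) n) = (\<Sum>i\<in>UNIV. ln (m i ^ n i / fact (n i) * exp (- m i)))"
    unfolding pmf_poisson_product[OF assms] 
    by (intro ln_prod less_imp_neq[THEN not_sym] mult_pos_pos divide_pos_pos zero_less_power) (use assms in auto)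
  also have "\<dots> = (\<Sum>i\<in>UNIV. - (m i - real (n i) * ln (m i) + ln (fact (n i))))"
    using assms[rule_format, THEN less_imp_neq, THEN not_sym]
    by (intro sum.cong refl) (simp add: ln_mult ln_div ln_realpow assms)
  finally show ?thesis by (simp only: sum_negf minus_minus)
qed

text \<open>From \<open>fact n \<le> n ^ n\<close>; together with the second Poisson moment it makes
  \<open>ln (fact (n i))\<close> integrable under the product.\<close>

lemma ln_fact_le_square: "ln (fact n) \<le> (real n)\<^sup>2"
proof (cases "n = 0")
  case False
  have "ln (fact n) \<le> ln (real n ^ n)"
    using fact_le_power[of n, where 'a = real] by (intro ln_mono) auto
  also have "\<dots> \<le> real n * real n"
    using False ln_le_minus_one[of "real n"] by (simp add: ln_realpow)
  finally show ?thesis by (simp add: power2_eq_square)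
qed simp

lemma map_pmf_coordinate_poisson_product:
  "map_pmf (\<lambda>n. n i) (poisson_product m) = poisson_pmf (m i)"
  unfolding poisson_product_def by (subst Pi_pmf_component) auto

text \<open>Pass to the \<open>i\<close>-th marginals, whose generating functions are ordered by
  \<open>WLSI1_pgf\<close> and \<open>pgf_le_exp\<close>. Integrability under \<open>\<mu>\<close>
  is itself a result of the comparison, since the Poisson side is finite.\<close>

lemma WLSI1_ln_fact:
  fixes m :: "'d::finite \<Rightarrow> real"
  assumes m: "\<forall>i. 0 < m i" and \<mu>: "\<mu> \<in> WLSI1" "has_mean \<mu> m"
  shows "integrable (measure_pmf \<mu>) (\<lambda>n. ln (fact (n i)) :: real)"
    and "measure_pmf.expectation \<mu> (\<lambda>n. ln (fact (n i)) :: real)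
      \<le> measure_pmf.expectation (poisson_product m) (\<lambda>n. ln (fact (n i)))"
proof -
  let ?\<pi> = "poisson_product m"
  let ?p = "map_pmf (\<lambda>n. n i) \<mu>"
  have mean: "has_bochner_integral \<mu> (\<lambda>n. real (n i)) (m i)"
    using \<mu>(2) by (simp add: has_mean_def has_bochner_integral_iff)
  then have p: "integrable ?p real" "measure_pmf.expectation ?p real = m i"
    by (auto simp: has_bochner_integral_iff integrable_map_pmf_eq)
  have q: "integrable (poisson_pmf (m i)) real" "measure_pmf.expectation (poisson_pmf (m i)) real = m i"
    using poisson_product_moments(1)[OF m, of i]
    by (auto simp: has_bochner_integral_iff map_pmf_coordinate_poisson_product[symmetric] integrable_map_pmf_eq)
  have "measure_pmf.expectation ?p (\<lambda>k. z ^ k) \<le> exp (- (m i * (1 - z)))" if z: "0 < z" "z < 1" for z :: real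
    using pgf_le_exp[OF p(1) _ z] p(2) WLSI1_pgf[OF \<mu>(1), of i] mean
    by (simp add: has_bochner_integral_iff)
  then have le: "(\<integral>\<^sup>+k. ennreal (ln (fact k)) \<partial>measure_pmf ?p) \<le> (\<integral>\<^sup>+k. ennreal (ln (fact k)) \<partial>measure_pmf (poisson_pmf (m i)))"
    using m by (intro nn_integral_ln_fact_mono p(1) q(1)) (simp_all only: p(2) q(2) poisson_pgf)
  then have le': "(\<integral>\<^sup>+n. ennreal (ln (fact (n i))) \<partial>measure_pmf \<mu>) \<le> (\<integral>\<^sup>+n. ennreal (ln (fact (n i))) \<partial>measure_pmf ?\<pi>)"
    by (simp add: map_pmf_coordinate_poisson_product[of i m, symmetric])
  have nonneg: "0 \<le> ln (fact k :: real)" for k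
    by (simp add: fact_ge_1)
  have int\<pi>: "integrable ?\<pi> (\<lambda>n. ln (fact (n i)) :: real)"
    by (rule Bochner_Integration.integrable_bound[OF poisson_product_moments(2)[OF m, of i]])
      (use nonneg ln_fact_le_square in auto)
  then have eq\<pi>: "(\<integral>\<^sup>+n. ennreal (ln (fact (n i))) \<partial>measure_pmf ?\<pi>)
      = ennreal (measure_pmf.expectation ?\<pi> (\<lambda>n. ln (fact (n i))))"
    using nonneg by (intro nn_integral_eq_integral) auto
  then show int: "integrable (measure_pmf \<mu>) (\<lambda>n. ln (fact (n i)) :: real)"
    using nonneg le' by (intro integrableI_bounded) (auto simp: le_less_trans less_top)
  have "(\<integral>\<^sup>+n. ennreal (ln (fact (n i))) \<partial>measure_pmf \<mu>)
      = ennreal (measure_pmf.expectation \<mu> (\<lambda>n. ln (fact (n i))))"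
    using nonneg int by (intro nn_integral_eq_integral) auto
  then show "measure_pmf.expectation \<mu> (\<lambda>n. ln (fact (n i)) :: real)
      \<le> measure_pmf.expectation ?\<pi> (\<lambda>n. ln (fact (n i)))"
    using le' nonneg by (simp add: eq\<pi> ennreal_le_iff integral_nonneg_AE)
qed

text \<open>\<open>V\<close> is affine in \<open>n\<close> apart from the terms
  \<open>ln (fact (n i))\<close>. The affine part has the same expectation under all laws with mean
  \<open>m\<close>, so \<open>WLSI1_ln_fact\<close> decides.\<close>

lemma WLSI1_cross_entropy:
  fixes m :: "'d::finite \<Rightarrow> real"
  defines "V \<equiv> \<lambda>n. - ln (pmf (poisson_product m) n)"
  assumes m: "\<forall>i. 0 < m i" and \<mu>: "\<mu> \<in> WLSI1" "has_mean \<mu> m"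
  shows "integrable (measure_pmf \<mu>) V"
    and "measure_pmf.expectation \<mu> V \<le> measure_pmf.expectation (poisson_product m) V"
proof -
  \<comment> \<open>Stated for a general \<open>\<nu>\<close> so that it serves both
    \<open>\<mu>\<close> and the Poisson product, itself a member of \<open>WLSI1\<close>.\<close>
  have "integrable (measure_pmf \<nu>) V \<and> measure_pmf.expectation \<nu> V =
      (\<Sum>i\<in>UNIV. m i - m i * ln (m i) + measure_pmf.expectation \<nu> (\<lambda>n. ln (fact (n i))))"
    if "\<nu> \<in> WLSI1" "has_mean \<nu> m" for \<nu>
  proof -
    have "integrable (measure_pmf \<nu>) (\<lambda>n. real (n i))" "measure_pmf.expectation \<nu> (\<lambda>n. real (n i)) = m i" for i
      using that(2) by (auto simp: has_mean_def)
    then show ?thesis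
      using WLSI1_ln_fact(1)[OF m that] by (simp add: V_def ln_pmf_poisson_product[OF m])
  qed
  note * = this
  show "integrable (measure_pmf \<mu>) V" using *[OF \<mu>] by simp
  show "measure_pmf.expectation \<mu> V \<le> measure_pmf.expectation (poisson_product m) V"
    using *[OF \<mu>] *[OF poisson_product_mem_WLSI1[OF m] has_mean_poisson_product[OF m]]
      WLSI1_ln_fact(2)[OF m \<mu>]
    by (simp add: sum_mono)
qed

theorem theorem5p3:
  fixes m :: "'d::finite \<Rightarrow> real"
  assumes "\<And>i. 0 < m i"
  shows "shannon_entropy (poisson_product m) < \<infinity> \<and>
    (\<forall>\<mu> :: ('d \<Rightarrow> nat) pmf.
       downward_closed (set_pmf \<mu>) \<longrightarrow> \<mu> \<in> WLSI1 \<longrightarrow> has_mean \<mu> m \<longrightarrow>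
         shannon_entropy (poisson_product m) - shannon_entropy \<mu>
           \<ge> relative_entropy \<mu> (poisson_product m) \<and>
         relative_entropy \<mu> (poisson_product m) \<ge> 0) \<and>
    (\<forall>\<nu> :: ('d \<Rightarrow> nat) pmf.
       is_arg_max shannon_entropy (\<lambda>\<mu>. \<mu> \<in> WLSI1 \<and> has_mean \<mu> m) \<nu> \<longleftrightarrow> \<nu> = poisson_product m)"
proof -
  let ?\<pi> = "poisson_product m"
  let ?V = "\<lambda>n. - ln (pmf ?\<pi> n)"
  have m: "\<forall>i. 0 < m i" using assms by simp
  note \<pi> = poisson_product_mem_WLSI1[OF m] has_mean_poisson_product[OF m]
  define H where "H = measure_pmf.expectation ?\<pi> ?V"
  have "((\<lambda>n. pmf ?\<pi> n * ?V n) has_sum H) (set_pmf ?\<pi>)"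
    unfolding H_def by (intro pmf_mult_has_sum WLSI1_cross_entropy(1)[OF m \<pi>])
  then have H: "shannon_entropy ?\<pi> = ereal H"
    unfolding shannon_entropy_def by (intro infsumI) (use has_sum_ereal in fastforce)
  \<comment> \<open>\<open>v\<close> is the cross entropy of \<open>\<mu>\<close> and
    \<open>H\<close> that of the Poisson product with itself, hence its entropy. The relative
    entropy \<open>v - h\<close> therefore lies between 0 and \<open>H - h\<close>.\<close>
  have main: "\<exists>h v. shannon_entropy \<mu> = ereal h \<and> relative_entropy \<mu> ?\<pi> = ereal (v - h)
      \<and> h \<le> v \<and> v \<le> H \<and> (h = v \<longrightarrow> \<mu> = ?\<pi>)" if "\<mu> \<in> WLSI1" "has_mean \<mu> m" for \<mu>
    using gibbs[OF pmf_poisson_product_pos[OF m] WLSI1_cross_entropy(1)[OF m that]]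
      WLSI1_cross_entropy(2)[OF m that] unfolding H_def by metis
  have "is_arg_max shannon_entropy (\<lambda>\<mu>. \<mu> \<in> WLSI1 \<and> has_mean \<mu> m) \<nu> \<longleftrightarrow> \<nu> = ?\<pi>" for \<nu>
  proof
    assume \<nu>: "is_arg_max shannon_entropy (\<lambda>\<mu>. \<mu> \<in> WLSI1 \<and> has_mean \<mu> m) \<nu>"
    then obtain h v where hv: "shannon_entropy \<nu> = ereal h" "h \<le> v" "v \<le> H" "h = v \<longrightarrow> \<nu> = ?\<pi>"
      using main[of \<nu>] by (auto simp: is_arg_max_def)
    \<comment> \<open>Maximality gives \<open>H \<le> h\<close>, which collapses
      \<open>h \<le> v \<le> H\<close> to equalities and triggers the equality case of
      \<open>gibbs\<close>.\<close>
    moreover have "\<not> shannon_entropy \<nu> < shannon_entropy ?\<pi>"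
      using \<nu> \<pi> by (auto simp: is_arg_max_def)
    ultimately show "\<nu> = ?\<pi>" by (simp add: H)
  next
    assume "\<nu> = ?\<pi>"
    then show "is_arg_max shannon_entropy (\<lambda>\<mu>. \<mu> \<in> WLSI1 \<and> has_mean \<mu> m) \<nu>"
      using \<pi> main by (fastforce simp: is_arg_max_def H)
  qed
  moreover have "shannon_entropy ?\<pi> - shannon_entropy \<mu> \<ge> relative_entropy \<mu> ?\<pi> \<and> relative_entropy \<mu> ?\<pi> \<ge> 0"
    if "\<mu> \<in> WLSI1" "has_mean \<mu> m" for \<mu>
    using main[OF that] by (auto simp: H)
  ultimately show ?thesis by (simp add: H)
qed

end
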